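(* Let $d_0>1$ be a square-free integer. Let $f>2$ be coprime with $d_0$. Let $H$ be a subgroup of the multiplicative group $(\mathbb{Z}/f\mathbb{Z})^*$. Whenever $\delta$ divides $d_0$, let $s_\delta:(\mathbb{Z}/\delta f\mathbb{Z})^*\longrightarrow (\mathbb{Z}/f\mathbb{Z})^*$ be the canonical surjective morphism and set $H_{\delta}=s_\delta^{-1}(H)$ and $H_{\delta}' =s_\delta^{-1}(H\setminus\{1\})$. Define the rational number $$N_{d_0}(f,H)=-f+\frac{12\mu(d_0)}{\prod_{q\mid d_0}(q^2-1)}\sum_{\delta\mid d_0}\delta\mu (\delta)\sum_{h\in H_{d_0}}s(h,\delta f).$$ Then, for $p\geq 3$ a prime which does not divide $d_0$ and $H$ a subgroup of odd order of the multiplicative group $(\mathbb{Z}/p\mathbb{Z})^*$, we have $$M_{d_0}(p,H)=\frac{2\pi^2\mu(d_0)\phi(d_0)}{d_0^2p}\sum_{\delta\mid d_0}\frac{\delta\mu(\delta)}{\phi(\delta)}S(H_\delta,\delta p),\qquad\text{where } S(H_\delta,\delta f)=\sum_{h\in H_\delta}s(h,\delta f),$$ and $$M_{d_0}(p,H)=\kappa_{d_0}\left(1+\frac{N_{d_0}(p,H)}{p}\right),\qquad \kappa_{d_0}:=\frac{\pi^2}{6}\prod_{q\mid d_0}\left(1-\frac{1}{q^2}\right).$$ Moreover, $$N_{d_0}(f,H)=-f+\frac{12\mu(d_0)}{\prod_{q\mid d_0}(q+1)}\sum_{\delta\mid d_0}\frac{\delta\mu(\delta)}{\phi(\delta)}S(H_\delta,\delta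 f)=N_{d_0}(f,\{1\})+\frac{12\mu(d_0)}{\prod_{q\mid d_0}(q+1)}\sum_{\delta\mid d_0}\frac{\delta\mu(\delta)}{\phi(\delta)}S'(H_{\delta},\delta f),$$ where $S'(H_{\delta},\delta f):=\sum_{h\in H_{\delta}'}s(h,\delta f)$.
   Context: Here $s(c,d)$ denotes the Dedekind sum $s(c,d)=\frac{1}{4d}\sum_{n=1}^{|d|-1}\cot\left(\frac{\pi n}{d}\right)\cot\left(\frac{\pi nc}{d}\right)$ for $\gcd(c,d)=1$, which depends only on $c$ modulo $|d|$. Products over $q\mid d_0$ run over the distinct prime divisors of $d_0$; $\mu$ is the Möbius function and $\phi$ Euler's totient. For $f>2$ and $H$ a subgroup of $(\mathbb{Z}/f\mathbb{Z})^*$ with $-1\notin H$, $X_f^-(H)$ is the set of odd Dirichlet characters $\chi$ modulo $f$ ($\chi(-1)=-1$) that are trivial on $H$; for $\chi$ modulo $f$, $\chi'$ denotes the character modulo $d_0f$ induced by $\chi$; and $M_{d_0}(f,H):=\frac{1}{\# X_f^-(H)}\sum_{\chi\in X_f^-(H)}|L(1,\chi')|^2$ is the mean square value of $L(1,\chi')$. *)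

theory Defs
  imports
    "HOL-Analysis.Analysis"
    "HOL-Number_Theory.Number_Theory"
    "HOL-Computational_Algebra.Squarefree"
begin

text \<open>
  Elements of \<open>(\<int>/m\<int>)\<^sup>*\<close> are represented by their residues in \<open>{0..m - 1}\<close>; the library's
  \<open>residue_ring m\<close> is \<open>\<int>/m\<int>\<close> for \<open>m > 1\<close> only, which covers every modulus used below.
\<close>

abbreviation unit_group_mod :: "nat \<Rightarrow> int monoid" where
  "unit_group_mod m \<equiv> units_of (residue_ring (int m))"

text \<open>
  The inverse image \<open>s\<^sub>\<delta>\<^sup>-\<^sup>1(A)\<close> under the canonical morphism
  \<open>s\<^sub>\<delta> : (\<int>/\<delta>f\<int>)\<^sup>* \<rightarrow> (\<int>/f\<int>)\<^sup>*\<close>, \<open>h \<mapsto> h mod f\<close>. So \<open>H\<^sub>\<delta>\<close> is \<open>canon_preimage \<delta> f H\<close>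
  and \<open>H\<^sub>\<delta>'\<close> is \<open>canon_preimage \<delta> f (H - {1})\<close>.
\<close>

definition canon_preimage :: "nat \<Rightarrow> nat \<Rightarrow> int set \<Rightarrow> int set" where
  "canon_preimage \<delta> f A = (\<lambda>h. h mod int f) -` A \<inter> carrier (unit_group_mod (\<delta> * f))"

definition dedekind_sum :: "int \<Rightarrow> int \<Rightarrow> real" where
  "dedekind_sum c d =
     1 / (4 * real_of_int d) *
     (\<Sum>n = 1..\<bar>d\<bar> - 1. cot (pi * real_of_int n / real_of_int d) *
                       cot (pi * real_of_int n * real_of_int c / real_of_int d))"

definition moebius_mu :: "nat \<Rightarrow> int" where
  "moebius_mu n = (if squarefree n then (-1) ^ card (prime_factors n) else 0)"

text \<open>
  A Dirichlet character modulo \<open>m\<close> is viewed as a function on all integers, vanishing exactly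
  at the arguments that are not coprime to \<open>m\<close>.
\<close>

definition dirichlet_character :: "nat \<Rightarrow> (int \<Rightarrow> complex) \<Rightarrow> bool" where
  "dirichlet_character m \<psi> \<longleftrightarrow>
     (\<forall>a b. \<psi> (a * b) = \<psi> a * \<psi> b) \<and>
     (\<forall>a. \<psi> (a + int m) = \<psi> a) \<and>
     (\<forall>a. \<psi> a \<noteq> 0 \<longleftrightarrow> coprime a (int m))"

text \<open>The character modulo a multiple \<open>m\<close> of the modulus of \<open>\<psi>\<close> that is induced by \<open>\<psi>\<close>.\<close>

definition induced_character :: "nat \<Rightarrow> (int \<Rightarrow> complex) \<Rightarrow> (int \<Rightarrow> complex)" where
  "induced_character m \<psi> = (\<lambda>a. if coprime a (int m) then \<psi> a else 0)"

text \<open>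
  The series runs over \<open>n \<ge> 1\<close> in increasing order. For a non-principal character (in particular
  an odd one) it converges, conditionally for \<open>0 < Re s \<le> 1\<close>, so that its sum at \<open>s = 1\<close> is
  \<open>L(1, \<psi>)\<close>.
\<close>

definition dirichlet_L :: "complex \<Rightarrow> (int \<Rightarrow> complex) \<Rightarrow> complex" where
  "dirichlet_L s \<psi> = (\<Sum>n. \<psi> (int (Suc n)) / of_nat (Suc n) powr s)"

definition odd_characters :: "nat \<Rightarrow> int set \<Rightarrow> (int \<Rightarrow> complex) set" where
  "odd_characters f H =
     {\<psi>. dirichlet_character f \<psi> \<and> \<psi> (-1) = -1 \<and> (\<forall>h\<in>H. \<psi> h = 1)}"

definition mean_square_L :: "nat \<Rightarrow> nat \<Rightarrow> int set \<Rightarrow> real" where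
  "mean_square_L d0 f H =
     1 / real (card (odd_characters f H)) *
     (\<Sum>\<psi>\<in>odd_characters f H. (cmod (dirichlet_L 1 (induced_character (d0 * f) \<psi>)))\<^sup>2)"

definition sum_dedekind :: "int set \<Rightarrow> nat \<Rightarrow> real" where
  "sum_dedekind A m = (\<Sum>h\<in>A. dedekind_sum h (int m))"

definition N_term :: "nat \<Rightarrow> nat \<Rightarrow> int set \<Rightarrow> real" where
  "N_term d0 f H =
     - real f +
     12 * real_of_int (moebius_mu d0) / (\<Prod>q\<in>prime_factors d0. (real q)\<^sup>2 - 1) *
     (\<Sum>\<delta> | \<delta> dvd d0. real \<delta> * real_of_int (moebius_mu \<delta>) *
        (\<Sum>h\<in>canon_preimage d0 f H. dedekind_sum h (int (\<delta> * f))))"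

definition kappa :: "nat \<Rightarrow> real" where
  "kappa d0 = pi\<^sup>2 / 6 * (\<Prod>q\<in>prime_factors d0. 1 - 1 / (real q)\<^sup>2)"

end

theory Submission
  imports Defs
begin

text \<open>
  For an odd function \<open>\<psi>\<close> of period \<open>m\<close>, the partial fraction expansion of the cotangent gives
  \<open>L(1,\<psi>) = \<pi>/(2m) \<Sum>\<^sub>a \<psi>(a) cot(\<pi>a/m)\<close>. Expand \<open>|L(1,\<chi>')|\<^sup>2\<close> for \<open>m = d\<^sub>0p\<close> and average over
  \<open>X\<^sub>p\<^sup>-(H)\<close>: since the mean of \<open>\<chi>(h)\<close> is \<open>1\<close>, \<open>-1\<close> or \<open>0\<close> according to whether \<open>h \<in> H\<close>,
  \<open>-h \<in> H\<close> or neither, what remains is a sum over \<open>h \<in> H\<^bsub>d0\<^esub>\<close> of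
  \<open>\<Sum>\<^sub>b cot(\<pi>b/m) cot(\<pi>bh/m)\<close>, with \<open>b\<close> running over the units modulo \<open>m\<close>.
  Moebius inversion turns the inner sum into a combination of \<open>s(h,\<delta>p)\<close> and \<open>s(h,\<delta>)\<close> for
  \<open>\<delta> | d\<^sub>0\<close>. The terms \<open>s(h,\<delta>)\<close> cancel, because \<open>H\<^bsub>d0\<^esub>\<close> is \<open>H \<times> (\<int>/d\<^sub>0\<int>)\<^sup>*\<close> by the Chinese
  remainder theorem and \<open>s(-h,\<delta>) = -s(h,\<delta>)\<close>. By the same theorem all fibres of
  \<open>H\<^bsub>d0\<^esub> \<rightarrow> H\<^sub>\<delta>\<close> have \<open>\<phi>(d\<^sub>0)/\<phi>(\<delta>)\<close> elements, which converts sums over \<open>H\<^bsub>d0\<^esub>\<close> into the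
  sums \<open>S(H\<^sub>\<delta>,\<delta>f)\<close>.
\<close>

section \<open>The value of an L-series at 1 as a cotangent sum\<close>

text \<open>This is the logarithmic derivative of the reflection formula. It is taken in the form
  \<open>rGamma z * rGamma (1 - z) = sin (pi * z) / pi\<close>, whose two sides are entire, and the
  two derivatives at \<open>z\<close> are compared.\<close>

lemma Digamma_reflection:
  fixes z :: complex
  assumes "z \<notin> \<int>"
  shows "Digamma (1 - z) - Digamma z = of_real pi * cot (of_real pi * z)"
proof -
  have z: "z \<notin> \<int>\<^sub>\<le>\<^sub>0" "1 - z \<notin> \<int>\<^sub>\<le>\<^sub>0"
    using assms Ints_diff[of 1 "1 - z"] nonpos_Ints_Int by force+
  have "((\<lambda>z. rGamma z * rGamma (1 - z)) has_field_derivative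
           (- rGamma z * Digamma z * rGamma (1 - z) + rGamma z * (rGamma (1 - z) * Digamma (1 - z)))) (at z)"
    using z by (auto intro!: derivative_eq_intros simp: algebra_simps)
  moreover have "((\<lambda>z. sin (of_real pi * z) / of_real pi) has_field_derivative cos (of_real pi * z)) (at z)"
    by (auto intro!: derivative_eq_intros)
  ultimately have "- rGamma z * Digamma z * rGamma (1 - z) + rGamma z * (rGamma (1 - z) * Digamma (1 - z))
      = cos (of_real pi * z)"
    unfolding rGamma_reflection_complex by (rule DERIV_unique)
  then have "rGamma z * rGamma (1 - z) * (Digamma (1 - z) - Digamma z) = cos (of_real pi * z)"
    by (simp add: algebra_simps)
  moreover have "sin (of_real pi * z) \<noteq> 0"
  proof
    assume "sin (of_real pi * z) = 0"
    then have "rGamma z * rGamma (1 - z) = 0" by (simp add: rGamma_reflection_complex)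
    with z show False by (simp add: rGamma_eq_zero_iff)
  qed
  ultimately show ?thesis
    by (simp add: rGamma_reflection_complex cot_def field_simps)
qed

text \<open>Subtracting the series of \<open>Digamma\<close> at \<open>z\<close> from the one at
  \<open>1 - z\<close> cancels the terms \<open>1 / (k + 1)\<close> and leaves the partial fractions
  of the cotangent, the pole at \<open>-k\<close> being paired with the pole at
  \<open>k + 1\<close>.\<close>

lemma cot_sums_complex:
  fixes z :: complex
  assumes "z \<notin> \<int>"
  shows "(\<lambda>k. 1 / (z + of_nat k) - 1 / (of_nat k + 1 - z)) sums (of_real pi * cot (of_real pi * z))"
proof -
  have "z \<noteq> 0" "1 - z \<noteq> 0" using assms by auto
  note S = this[THEN summable_Digamma, THEN summable_sums]
  have "(\<lambda>k. (inverse (of_nat (Suc k)) - inverse (1 - z + of_nat k)) -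
      (inverse (of_nat (Suc k)) - inverse (z + of_nat k))) sums (Digamma (1 - z) - Digamma z)"
    using sums_diff[OF S(2) S(1)] by (simp add: Digamma_def)
  then show ?thesis
    using assms by (simp add: Digamma_reflection divide_inverse algebra_simps)
qed

lemma cot_sums:
  fixes x :: real
  assumes "x \<notin> \<int>"
  shows "(\<lambda>k. 1 / (x + real k) - 1 / (real k + 1 - x)) sums (pi * cot (pi * x))"
proof -
  have "complex_of_real x \<notin> \<int>"
    using assms by (metis Ints_cases Ints_of_int of_real_eq_iff of_real_of_int_eq)
  from cot_sums_complex[OF this]
  have "(\<lambda>k. complex_of_real (1 / (x + real k) - 1 / (real k + 1 - x))) sums
      complex_of_real (pi * cot (pi * x))"
    by (simp add: cot_of_real)
  then show ?thesis by (simp only: sums_of_real_iff)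
qed

text \<open>Needed because the cotangent series controls an L-series only through its sums over
  whole periods. A partial sum differs from the last one at a block boundary by fewer than
  \<open>m\<close> terms, and these tend to \<open>0\<close>.\<close>

lemma sums_blockwise:
  fixes f :: "nat \<Rightarrow> 'a::real_normed_vector"
  assumes m: "m > 0" and lim: "f \<longlonglongrightarrow> 0"
    and blocks: "(\<lambda>k. \<Sum>r<m. f (k * m + r)) sums s"
  shows "f sums s"
proof -
  have "(\<lambda>k. \<Sum>i<k * m. f i) \<longlonglongrightarrow> s"
  proof -
    have "(\<Sum>r<m. f (k * m + r)) = sum f {k * m..<k * m + m}" for k
      using sum.shift_bounds_nat_ivl[of f 0 "k * m" m] by (simp add: add.commute atLeast0LessThan)
    with blocks show ?thesis by (simp add: sums_def sum.nat_group)
  qed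
  then have 1: "(\<lambda>N. \<Sum>i<N div m * m. f i) \<longlonglongrightarrow> s"
    by (rule filterlim_compose) (use m in \<open>simp add: filterlim_at_top_div_const_nat\<close>)
  \<comment> \<open>The incomplete block at the end is bounded by the norms of all \<open>m\<close>
    terms of that block, a fixed number of null sequences.\<close>
  have tail: "(\<lambda>N. \<Sum>r<m. norm (f (N div m * m + r))) \<longlonglongrightarrow> (\<Sum>r<m. norm (0::'a))"
  proof (intro tendsto_intros tendsto_norm filterlim_compose[OF lim])
    fix r
    have "filterlim (\<lambda>N. N div m) at_top at_top"
      using m by (simp add: filterlim_at_top_div_const_nat)
    then show "filterlim (\<lambda>N. N div m * m + r) at_top at_top"
      by (rule filterlim_at_top_mono) (use m in \<open>auto intro!: always_eventually trans_le_add1\<close>)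
  qed
  have "(\<lambda>N. (\<Sum>i<N. f i) - (\<Sum>i<N div m * m. f i)) \<longlonglongrightarrow> 0"
  proof (rule Lim_null_comparison)
    show "\<forall>\<^sub>F N in sequentially. norm ((\<Sum>i<N. f i) - (\<Sum>i<N div m * m. f i))
             \<le> (\<Sum>r<m. norm (f (N div m * m + r)))"
    proof (intro always_eventually allI)
      fix N
      define q where "q = N div m * m"
      have "N = q + N mod m" "N mod m < m" using m by (simp_all add: q_def)
      then have q: "q \<le> N" "N \<le> q + m" by linarith+
      have "(\<Sum>i<N. f i) - (\<Sum>i<q. f i) = (\<Sum>i=q..<N. f i)"
        using q by (metis sum_diff_nat_ivl atLeast0LessThan le0)
      also have "norm \<dots> \<le> (\<Sum>i=q..<N. norm (f i))" by (rule norm_sum)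
      also have "\<dots> \<le> (\<Sum>i=q..<q+m. norm (f i))"
        using q by (intro sum_mono2) auto
      also have "\<dots> = (\<Sum>r<m. norm (f (q + r)))"
        using sum.shift_bounds_nat_ivl[of "\<lambda>i. norm (f i)" 0 q m] by (simp add: add.commute atLeast0LessThan)
      finally show "norm ((\<Sum>i<N. f i) - (\<Sum>i<N div m * m. f i)) \<le> (\<Sum>r<m. norm (f (N div m * m + r)))"
        by (simp add: q_def)
    qed
    show "(\<lambda>N. \<Sum>r<m. norm (f (N div m * m + r))) \<longlonglongrightarrow> 0" using tail by simp
  qed
  from tendsto_add[OF this 1] show ?thesis by (simp add: sums_def)
qed

lemma periodic_int_mult:
  fixes \<psi> :: "int \<Rightarrow> 'a"
  assumes "\<And>a. \<psi> (a + int m) = \<psi> a"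
  shows "\<psi> (a + int m * k) = \<psi> a"
proof -
  have nat: "\<psi> (a + int m * int k) = \<psi> a" for a k
  proof (induction k)
    case (Suc k)
    have "a + int m * int (Suc k) = a + int m * int k + int m" by (simp add: algebra_simps)
    with Suc show ?case using assms by presburger
  qed simp
  show ?thesis
  proof (cases "k \<ge> 0")
    case True
    then show ?thesis using nat[of a "nat k"] by simp
  next
    case False
    then show ?thesis using nat[of "a + int m * k" "nat (- k)"] by simp
  qed
qed

text \<open>Within the \<open>k\<close>-th period, oddness pairs \<open>r\<close> with
  \<open>m - r\<close>, and the paired terms are, up to a constant, those of the cotangent series at
  \<open>r / m\<close>. Convergence by periods then gives convergence of the series itself.\<close>

lemma dirichlet_L_odd_periodic:
  fixes \<psi> :: "int \<Rightarrow> complex"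
  assumes m: "m > 0" and per: "\<And>a. \<psi> (a + int m) = \<psi> a"
    and odd: "\<And>a. \<psi> (- a) = - \<psi> a"
  shows "dirichlet_L 1 \<psi> =
    of_real (pi / (2 * real m)) * (\<Sum>a=1..int m - 1. \<psi> a * of_real (cot (pi * real_of_int a / real m)))"
proof -
  have per': "\<psi> (int m * k + a) = \<psi> a" for a k
    using periodic_int_mult[of \<psi>, OF per] by (simp add: add.commute)
  have "\<psi> 0 = 0" using odd[of 0] by simp
  then have zero: "\<psi> (int m * k) = 0" for k using per'[of k 0] by simp
  have reflect: "\<psi> (int m - a) = - \<psi> a" for a
    using per[of "- a"] odd[of a] by (simp add: add.commute)
  define f where "f n = \<psi> (int n) / of_nat n" for n
  define C where "C r = pi * cot (pi * (real r / real m))" for r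
  \<comment> \<open>\<open>t k r\<close> is the \<open>k\<close>-th term of the cotangent series at
    \<open>r / m\<close>, divided by \<open>m\<close>.\<close>
  define t where "t k r = 1 / (real k * real m + real r) - 1 / (real k * real m + real (m - r))" for k r
  have cotC: "(\<lambda>k. t k r) sums (C r / real m)" if r: "r \<in> {1..<m}" for r
  proof -
    have "real r / real m \<notin> \<int>"
    proof
      assume "real r / real m \<in> \<int>"
      moreover have "0 < real r / real m" "real r / real m < 1" using r by auto
      ultimately show False by (auto elim!: Ints_cases)
    qed
    from sums_divide[OF cot_sums[OF this], of "real m"]
    have "(\<lambda>k. (1 / (real r / real m + real k) - 1 / (real k + 1 - real r / real m)) / real m) sums (C r / real m)"
      by (simp add: C_def)
    also have "(\<lambda>k. (1 / (real r / real m + real k) - 1 / (real k + 1 - real r / real m)) / real m) = (\<lambda>k. t k r)"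
    proof
      fix k
      have "(real r / real m + real k) * real m = real k * real m + real r"
        "(real k + 1 - real r / real m) * real m = real k * real m + real (m - r)"
        using r by (auto simp: field_simps of_nat_diff)
      then show "(1 / (real r / real m + real k) - 1 / (real k + 1 - real r / real m)) / real m = t k r"
        unfolding t_def by (metis diff_divide_distrib divide_divide_eq_left)
    qed
    finally show ?thesis .
  qed
  have block: "(\<Sum>r<m. f (k * m + r)) = (\<Sum>r=1..<m. \<psi> (int r) * of_real (t k r)) / 2" for k
  proof -
    have f0: "f (k * m) = 0" using zero[of "int k"] by (simp add: f_def mult.commute)
    have fr: "f (k * m + r) = \<psi> (int r) / of_nat (k * m + r)" for r
      using per'[of "int k" "int r"] by (simp add: f_def mult.commute)
    have "(\<Sum>r<m. f (k * m + r)) = (\<Sum>r=1..<m. f (k * m + r))"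
      using f0 m by (simp add: lessThan_atLeast0 sum.atLeast_Suc_lessThan)
    \<comment> \<open>Adding the reflected copy counts the block twice, hence the division by
      2.\<close>
    moreover have "(\<Sum>r=1..<m. f (k * m + r)) = (\<Sum>r=1..<m. f (k * m + (m - r)))"
      by (rule sum.reindex_bij_witness[of _ "\<lambda>r. m - r" "\<lambda>r. m - r"]) auto
    ultimately have "2 * (\<Sum>r<m. f (k * m + r)) = (\<Sum>r=1..<m. f (k * m + r) + f (k * m + (m - r)))"
      by (simp add: sum.distrib)
    also have "\<dots> = (\<Sum>r=1..<m. \<psi> (int r) * of_real (t k r))"
    proof (rule sum.cong)
      fix r assume "r \<in> {1..<m}"
      then have "\<psi> (int (m - r)) = - \<psi> (int r)" using reflect[of "int r"] by (simp add: of_nat_diff)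
      then show "f (k * m + r) + f (k * m + (m - r)) = \<psi> (int r) * of_real (t k r)"
        unfolding fr t_def by (simp add: algebra_simps)
    qed simp
    finally show ?thesis by (simp add: field_simps)
  qed
  have "(\<lambda>k. \<Sum>r<m. f (k * m + r)) sums ((\<Sum>r=1..<m. \<psi> (int r) * of_real (C r / real m)) / 2)"
    unfolding block by (intro sums_divide sums_sum sums_mult sums_of_real cotC)
  moreover have "f \<longlonglongrightarrow> 0"
  proof -
    define B where "B = (\<Sum>r<m. norm (\<psi> (int r)))"
    have B: "norm (\<psi> (int n)) \<le> B" for n
    proof -
      have "\<psi> (int n) = \<psi> (int (n mod m))"
        using per'[of "int (n div m)" "int (n mod m)"] by (metis mult_div_mod_eq of_nat_add of_nat_mult)
      then show ?thesis unfolding B_def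
        using m member_le_sum[of "n mod m" "{..<m}" "\<lambda>r. norm (\<psi> (int r))"] by simp
    qed
    show ?thesis
    proof (rule Lim_null_comparison)
      show "\<forall>\<^sub>F n in sequentially. norm (f n) \<le> B / real n"
        using B by (auto simp: f_def norm_divide divide_right_mono)
      show "(\<lambda>n. B / real n) \<longlonglongrightarrow> 0" by (rule lim_const_over_n)
    qed
  qed
  ultimately have "f sums ((\<Sum>r=1..<m. \<psi> (int r) * of_real (C r / real m)) / 2)"
    using sums_blockwise[OF m] by blast
  \<comment> \<open>The index shift costs nothing because \<open>f 0 = 0\<close>.\<close>
  then have "(\<lambda>n. f (Suc n)) sums ((\<Sum>r=1..<m. \<psi> (int r) * of_real (C r / real m)) / 2)"
    by (subst sums_Suc_iff) (simp add: f_def)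
  then have "dirichlet_L 1 \<psi> = (\<Sum>r=1..<m. \<psi> (int r) * of_real (C r / real m)) / 2"
    by (simp add: dirichlet_L_def f_def sums_iff)
  also have "(\<Sum>r=1..<m. \<psi> (int r) * of_real (C r / real m)) =
      (\<Sum>a=1..int m - 1. \<psi> a * of_real (pi * cot (pi * real_of_int a / real m) / real m))"
    by (rule sum.reindex_bij_witness[of _ nat int]) (auto simp: C_def)
  finally show ?thesis by (simp add: sum_distrib_left sum_divide_distrib algebra_simps)
qed

section \<open>Units modulo m and Dedekind sums\<close>

text \<open>Least residues, described without the ring. For \<open>m = 1\<close> this is
  \<open>{0}\<close>, which has \<open>totient 1\<close> elements, so trivial cofactors need no
  separate treatment below.\<close>

definition units_mod :: "nat \<Rightarrow> int set" where
  "units_mod m = {u. 0 \<le> u \<and> u < int m \<and> coprime u (int m)}"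

lemma finite_units_mod [simp]: "finite (units_mod m)"
  by (rule finite_subset[of _ "{0..<int m}"]) (auto simp: units_mod_def)

lemma carrier_unit_group_mod:
  assumes "m > 1"
  shows "carrier (unit_group_mod m) = units_mod m"
proof -
  interpret residues "int m" "residue_ring (int m)"
    using assms by unfold_locales simp_all
  have "u \<noteq> 0" if "coprime u (int m)" for u
    using that assms by auto
  then show ?thesis
    unfolding units_of_carrier res_units_eq units_mod_def by (fastforce simp: less_le)
qed

lemma canon_preimage_eq:
  assumes "\<delta> * f > 1"
  shows "canon_preimage \<delta> f A = {h \<in> units_mod (\<delta> * f). h mod int f \<in> A}"
  unfolding canon_preimage_def carrier_unit_group_mod[OF assms] by auto

lemma mod_in_units_mod:
  assumes "m > 0" "coprime u (int m)"
  shows "u mod int m \<in> units_mod m"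
  using assms by (auto simp: units_mod_def)

lemma minus_in_units_mod:
  assumes "m > 1" "u \<in> units_mod m"
  shows "int m - u \<in> units_mod m"
proof -
  have u: "0 \<le> u" "u < int m" "coprime u (int m)" using assms(2) by (auto simp: units_mod_def)
  then have "u \<noteq> 0" using assms(1) by auto
  moreover have "coprime (int m - u) (int m)"
    using u(3) by (metis coprime_iff_gcd_eq_1 gcd_diff2)
  ultimately show ?thesis using u by (auto simp: units_mod_def)
qed

lemma card_units_mod:
  assumes "m > 0"
  shows "card (units_mod m) = totient m"
proof (cases "m = 1")
  case True
  then have "units_mod m = {0}" by (auto simp: units_mod_def)
  with True show ?thesis by simp
next
  case False
  with assms have m: "m > 1" by simp
  have "bij_betw nat (units_mod m) (totatives m)"
  proof (rule bij_betwI[where g = int])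
    show "nat \<in> units_mod m \<rightarrow> totatives m"
    proof
      fix u assume "u \<in> units_mod m"
      then have u: "0 \<le> u" "u < int m" "coprime u (int m)" by (auto simp: units_mod_def)
      then have "u \<noteq> 0" using m by auto
      with u show "nat u \<in> totatives m"
        by (auto simp: in_totatives_iff coprime_int_iff[symmetric])
    qed
    show "int \<in> totatives m \<rightarrow> units_mod m"
      using m by (auto simp: units_mod_def totatives_less in_totatives_iff)
    show "int (nat u) = u" if "u \<in> units_mod m" for u
      using that by (auto simp: units_mod_def)
  qed simp
  then show ?thesis by (simp add: totient_def bij_betw_same_card)
qed

lemma bij_betw_units_mod_chinese:
  assumes "a > 0" "b > 0" "coprime a b"
  shows "bij_betw (\<lambda>u. (u mod int a, u mod int b)) (units_mod (a * b)) (units_mod a \<times> units_mod b)"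
  unfolding bij_betw_def
proof
  show "inj_on (\<lambda>u. (u mod int a, u mod int b)) (units_mod (a * b))"
  proof (rule inj_onI)
    fix x y assume "x \<in> units_mod (a * b)" "y \<in> units_mod (a * b)"
      and eq: "(x mod int a, x mod int b) = (y mod int a, y mod int b)"
    then have "0 \<le> x" "x < int a * int b" "0 \<le> y" "y < int a * int b" by (auto simp: units_mod_def)
    moreover have "[x = y] (mod int a * int b)"
      using eq assms(3) by (intro coprime_cong_mult) (auto simp: cong_def)
    ultimately show "x = y" by (simp add: cong_less_imp_eq_int)
  qed
  show "(\<lambda>u. (u mod int a, u mod int b)) ` units_mod (a * b) = units_mod a \<times> units_mod b"
  proof (intro equalityI subsetI)
    fix w assume "w \<in> (\<lambda>u. (u mod int a, u mod int b)) ` units_mod (a * b)"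
    then show "w \<in> units_mod a \<times> units_mod b" using assms by (auto simp: units_mod_def)
  next
    fix w assume "w \<in> units_mod a \<times> units_mod b"
    then obtain u v where w: "w = (u, v)" and u: "0 \<le> u" "u < int a" "coprime u (int a)"
      and v: "0 \<le> v" "v < int b" "coprime v (int b)"
      by (auto simp: units_mod_def)
    obtain x where x: "[x = u] (mod int a)" "[x = v] (mod int b)"
      using binary_chinese_remainder_int[of "int a" "int b" u v] assms by auto
    have xab: "x mod int (a * b) mod int a = u" "x mod int (a * b) mod int b = v"
      using x u v by (simp_all add: mod_mod_cancel cong_def)
    have "coprime x (int a)" "coprime x (int b)"
      using x u v by (metis cong_imp_coprime cong_sym)+
    then have "x mod int (a * b) \<in> units_mod (a * b)"
      using assms by (intro mod_in_units_mod) auto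
    with xab show "w \<in> (\<lambda>u. (u mod int a, u mod int b)) ` units_mod (a * b)"
      unfolding w by (intro image_eqI[where x = "x mod int (a * b)"]) simp_all
  qed
qed

lemma sum_units_mod_chinese:
  assumes "a > 0" "b > 0" "coprime a b"
  shows "(\<Sum>h\<in>units_mod (a * b). g (h mod int a) (h mod int b)) =
    (\<Sum>u\<in>units_mod a. \<Sum>v\<in>units_mod b. g u v)"
  using sum.reindex_bij_betw[OF bij_betw_units_mod_chinese[OF assms], of "\<lambda>(u, v). g u v"]
  by (simp add: sum.cartesian_product)

text \<open>Under the Chinese remainder theorem, both \<open>F\<close> and the condition
  \<open>h mod f \<in> A\<close> see only the component modulo \<open>\<delta> * f\<close>. The
  component modulo \<open>e\<close> is free and contributes the factor
  \<open>totient e\<close>.\<close>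

lemma sum_canon_preimage_fibre:
  fixes F :: "int \<Rightarrow> real"
  assumes "\<delta> > 0" "e > 0" "f > 1" "coprime (\<delta> * f) e"
  shows "(\<Sum>h\<in>canon_preimage (\<delta> * e) f A. F (h mod int (\<delta> * f))) =
    real (totient e) * (\<Sum>h\<in>canon_preimage \<delta> f A. F h)"
proof -
  let ?g = "\<lambda>u (v::int). if u mod int f \<in> A then F u else 0"
  have gt: "\<delta> * f > 1" "\<delta> * e * f > 1"
    using assms by (metis less_le_trans mult_le_mono1 nat_mult_1 Suc_leI One_nat_def
        nat_0_less_mult_iff)+
  have "(\<Sum>h\<in>canon_preimage (\<delta> * e) f A. F (h mod int (\<delta> * f))) =
      (\<Sum>h\<in>units_mod (\<delta> * f * e). ?g (h mod int (\<delta> * f)) (h mod int e))"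
    unfolding canon_preimage_eq[OF gt(2)]
    by (simp add: sum.If_cases Int_def mod_mod_cancel mult.assoc mult.commute[of e] del: of_nat_mult)
  also have "\<dots> = (\<Sum>u\<in>units_mod (\<delta> * f). \<Sum>v\<in>units_mod e. ?g u v)"
    by (rule sum_units_mod_chinese) (use assms in auto)
  also have "\<dots> = real (totient e) * (\<Sum>u\<in>units_mod (\<delta> * f). ?g u 0)"
    using assms by (simp add: card_units_mod sum_distrib_left)
  also have "(\<Sum>u\<in>units_mod (\<delta> * f). ?g u 0) = (\<Sum>h\<in>canon_preimage \<delta> f A. F h)"
    unfolding canon_preimage_eq[OF gt(1)] by (simp add: sum.If_cases Int_def)
  finally show ?thesis .
qed

text \<open>The preimage is a product of a part modulo \<open>f\<close> and all units modulo
  \<open>d\<close>; the sum over the latter vanishes by pairing \<open>u\<close> with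
  \<open>d - u\<close>. This is what removes the terms \<open>s(h,\<delta>)\<close> from the mean
  square.\<close>

lemma sum_canon_preimage_odd:
  fixes G :: "int \<Rightarrow> real"
  assumes "d > 1" "f > 1" "coprime d f"
    and odd: "\<And>u. G (int d - u) = - G u"
  shows "(\<Sum>h\<in>canon_preimage d f A. G (h mod int d)) = 0"
proof -
  let ?g = "\<lambda>u v. if v \<in> A then G u else 0"
  have gt: "d * f > 1" using assms by (metis less_1_mult)
  have "(\<Sum>h\<in>canon_preimage d f A. G (h mod int d)) = (\<Sum>h\<in>units_mod (d * f). ?g (h mod int d) (h mod int f))"
    unfolding canon_preimage_eq[OF gt] by (simp add: sum.If_cases Int_def)
  also have "\<dots> = (\<Sum>u\<in>units_mod d. \<Sum>v\<in>units_mod f. ?g u v)"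
    by (rule sum_units_mod_chinese) (use assms in auto)
  also have "\<dots> = real (card (units_mod f \<inter> A)) * (\<Sum>u\<in>units_mod d. G u)"
    by (simp add: sum.If_cases sum_distrib_left)
  also have "(\<Sum>u\<in>units_mod d. G u) = 0"
  proof -
    have "(\<Sum>u\<in>units_mod d. G u) = (\<Sum>u\<in>units_mod d. G (int d - u))"
      by (rule sum.reindex_bij_witness[of _ "\<lambda>u. int d - u" "\<lambda>u. int d - u"]) (simp_all add: minus_in_units_mod[OF assms(1)])
    then show ?thesis by (simp add: odd sum_negf)
  qed
  finally show ?thesis by simp
qed

section \<open>Periodicity and oddness of Dedekind sums\<close>

lemma cot_add_int_pi: "cot (x + pi * of_int k) = cot (x::real)"
  using tan_periodic_int[of x k] by (simp add: cot_altdef mult.commute)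

lemma dedekind_sum_cong:
  assumes "[c = c'] (mod d)"
  shows "dedekind_sum c d = dedekind_sum c' d"
proof (cases "d = 0")
  case False
  obtain k where c: "c = c' + d * k"
    using assms by (metis cong_iff_lin cong_sym)
  have "cot (pi * of_int n * of_int c / of_int d) = cot (pi * of_int n * of_int c' / of_int d)" for n
  proof -
    have "pi * of_int n * of_int c / of_int d = pi * of_int n * of_int c' / of_int d + pi * real_of_int (n * k)"
      using False by (simp add: c field_simps)
    then show ?thesis by (simp only: cot_add_int_pi)
  qed
  then show ?thesis by (simp add: dedekind_sum_def)
qed (simp add: dedekind_sum_def)

lemma dedekind_sum_mod:
  assumes "d dvd m"
  shows "dedekind_sum (c mod m) d = dedekind_sum c d"
  using assms by (intro dedekind_sum_cong) (simp add: cong_def mod_mod_cancel)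

lemma dedekind_sum_minus: "dedekind_sum (- c) d = - dedekind_sum c d"
  by (simp add: dedekind_sum_def sum_negf)

section \<open>The Moebius function on divisors of a square-free number\<close>

lemma moebius_mu_1 [simp]: "moebius_mu (Suc 0) = 1"
  by (simp add: moebius_mu_def)

lemma moebius_mu_mult_coprime:
  assumes "coprime a b"
  shows "moebius_mu (a * b) = moebius_mu a * moebius_mu b"
proof (cases "squarefree (a * b)")
  case True
  then have ab: "a \<noteq> 0" "b \<noteq> 0" and sq: "squarefree a" "squarefree b"
    using squarefree_multD by (auto intro: Nat.gr0I)
  have "prime_factors a \<inter> prime_factors b = {}"
    using assms coprime_common_divisor[of a b] by (force simp: in_prime_factors_iff not_prime_unit)
  then have "card (prime_factors (a * b)) = card (prime_factors a) + card (prime_factors b)"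
    using ab by (simp add: prime_factors_product card_Un_disjoint)
  with True sq show ?thesis by (simp add: moebius_mu_def power_add)
next
  case False
  with assms have "\<not> squarefree a \<or> \<not> squarefree b" using squarefree_mult_coprime by blast
  with False show ?thesis by (auto simp: moebius_mu_def)
qed

lemma moebius_mu_square:
  assumes "squarefree n"
  shows "moebius_mu n * moebius_mu n = 1"
  using assms by (simp add: moebius_mu_def flip: power_mult_distrib)

lemma squarefree_cofactor:
  fixes n d :: nat
  assumes "squarefree n" "d dvd n"
  shows "coprime d (n div d)"
proof (rule coprimeI)
  fix c assume "c dvd d" "c dvd n div d"
  then have "c * c dvd d * (n div d)" by (rule mult_dvd_mono)
  with assms show "is_unit c" by (intro squarefreeD[OF assms(1)]) (simp add: power2_eq_square)
qed

text \<open>Multiplicativity together with \<open>moebius_mu d\<close> being its own inverse. It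
  turns the weights at complementary divisors produced by the sieve into those of the final
  formulas.\<close>

lemma moebius_mu_cofactor:
  assumes "squarefree n" "d dvd n"
  shows "moebius_mu (n div d) = moebius_mu n * moebius_mu d"
proof -
  have "moebius_mu n = moebius_mu d * moebius_mu (n div d)"
    using moebius_mu_mult_coprime[OF squarefree_cofactor[OF assms]] assms by simp
  moreover have "moebius_mu d * moebius_mu d = 1"
    using assms squarefree_mono by (intro moebius_mu_square) auto
  ultimately show ?thesis by (simp add: mult.commute mult.left_commute)
qed

text \<open>For a prime \<open>q\<close> dividing \<open>n\<close>, the divisors of \<open>n\<close>
  fall into pairs \<open>d\<close>, \<open>q * d\<close> with \<open>d\<close> dividing
  \<open>n div q\<close>, and the two values in a pair are opposite.\<close>

lemma sum_moebius_mu_divisors: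
  assumes "squarefree n"
  shows "(\<Sum>d | d dvd n. moebius_mu d) = (if n = 1 then 1 else 0)"
proof (cases "n = 1")
  case False
  then obtain q where q: "prime q" "q dvd n" using prime_factor_nat by blast
  define k where "k = n div q"
  have n: "n = q * k" and cop: "coprime q k"
    using q assms squarefree_cofactor by (auto simp: k_def)
  have n0: "n \<noteq> 0" using assms by (metis not_squarefree_0)
  then have k0: "k > 0" using n by auto
  have "{d. d dvd n} = {d. d dvd k} \<union> (\<lambda>d. q * d) ` {d. d dvd k}" (is "_ = ?A \<union> ?B")
  proof (intro equalityI subsetI)
    fix d assume "d \<in> {d. d dvd n}"
    then have d: "d dvd q * k" by (simp add: n)
    show "d \<in> ?A \<union> ?B"
    proof (cases "q dvd d")
      case True
      then obtain e where "d = q * e" by auto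
      with d q show ?thesis by auto
    next
      case False
      then have "coprime d q" using q by (metis prime_imp_coprime coprime_commute)
      with d show ?thesis by (simp add: coprime_dvd_mult_right_iff)
    qed
  qed (auto simp: n)
  moreover have "?A \<inter> ?B = {}"
    using cop q by (auto dest: dvd_mult_left simp: prime_nat_iff coprime_absorb_left)
  moreover have "finite ?A" using k0 by simp
  ultimately have "(\<Sum>d | d dvd n. moebius_mu d) = (\<Sum>d\<in>?A. moebius_mu d) + (\<Sum>d\<in>?B. moebius_mu d)"
    by (simp add: sum.union_disjoint)
  also have "(\<Sum>d\<in>?B. moebius_mu d) = (\<Sum>d\<in>?A. moebius_mu (q * d))"
    using q by (intro sum.reindex_cong[of "\<lambda>d. q * d"]) (auto simp: inj_on_def prime_gt_0_nat)
  also have "\<dots> = (\<Sum>d\<in>?A. - moebius_mu d)"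
  proof (rule sum.cong)
    fix d assume "d \<in> {d. d dvd k}"
    then have "coprime q d" using cop coprime_divisors[of q q d k] by simp
    then show "moebius_mu (q * d) = - moebius_mu d"
      using q by (simp add: moebius_mu_mult_coprime moebius_mu_def[of q] squarefree_prime prime_prime_factors)
  qed simp
  finally show ?thesis using False by (simp add: sum_negf)
qed simp

text \<open>The indices are the divisors of the gcd of \<open>n\<close> and \<open>b\<close>, so the
  preceding lemma applies to that gcd.\<close>

lemma sum_moebius_mu_coprime:
  assumes "squarefree n"
  shows "(\<Sum>e | e dvd n \<and> int e dvd b. moebius_mu e) = (if coprime b (int n) then 1 else 0)"
proof -
  let ?g = "gcd n (nat \<bar>b\<bar>)"
  have "{e. e dvd n \<and> int e dvd b} = {e. e dvd ?g}"
    by (metis gcd_greatest_iff dvd_nat_abs_iff)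
  moreover have "squarefree ?g" using assms squarefree_mono by blast
  moreover have "?g = 1 \<longleftrightarrow> coprime b (int n)"
    by (metis abs_of_nat coprime_iff_gcd_eq_1 gcd.commute gcd_int_def nat_int of_nat_eq_1_iff)
  ultimately show ?thesis by (simp add: sum_moebius_mu_divisors)
qed

lemma totient_squarefree:
  assumes "squarefree n"
  shows "real n = (\<Prod>q\<in>prime_factors n. real q)"
    and "real (totient n) = (\<Prod>q\<in>prime_factors n. real q - 1)"
proof -
  have n0: "n \<noteq> 0" using assms by (metis not_squarefree_0)
  have "n = (\<Prod>q\<in>prime_factors n. q ^ multiplicity q n)"
    using prime_factorization_nat n0 by blast
  also have "\<dots> = (\<Prod>q\<in>prime_factors n. q)"
    using assms by (intro prod.cong) (auto simp: squarefree_factorial_semiring' n0)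
  finally have "real n = real (\<Prod>q\<in>prime_factors n. q)" by simp
  then show n: "real n = (\<Prod>q\<in>prime_factors n. real q)" by simp
  have "real (totient n) = real n * (\<Prod>q\<in>prime_factors n. 1 - 1 / real q)"
    by (rule totient_formula2)
  also have "\<dots> = (\<Prod>q\<in>prime_factors n. real q * (1 - 1 / real q))"
    by (simp add: n prod.distrib)
  also have "\<dots> = (\<Prod>q\<in>prime_factors n. real q - 1)"
    by (intro prod.cong) (auto simp: field_simps dest!: in_prime_factors_imp_prime prime_gt_0_nat)
  finally show "real (totient n) = (\<Prod>q\<in>prime_factors n. real q - 1)" .
qed

text \<open>Moebius sieve: the coprimality condition is expanded into a sum over common divisors
  \<open>e\<close>, the sums are exchanged, and the multiples of \<open>e\<close> in the range are
  written as \<open>e * b\<close>.\<close>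

lemma sum_coprime_sieve:
  fixes F :: "int \<Rightarrow> real"
  assumes "squarefree d" "k > 0"
  shows "(\<Sum>b | b \<in> {1..int (d * k) - 1} \<and> coprime b (int d). F b) =
    (\<Sum>\<delta> | \<delta> dvd d. real_of_int (moebius_mu (d div \<delta>)) *
      (\<Sum>b=1..int (\<delta> * k) - 1. F (int (d div \<delta>) * b)))"
proof -
  have d0: "d > 0" using assms by (metis not_squarefree_0 gr0I)
  let ?I = "{1..int (d * k) - 1}"
  have fin: "finite {e. e dvd d}" using d0 by simp
  have "(\<Sum>b | b \<in> ?I \<and> coprime b (int d). F b) =
      (\<Sum>b\<in>?I. real_of_int (if coprime b (int d) then 1 else 0) * F b)"
    by (intro sum.mono_neutral_cong_left) auto
  also have "\<dots> = (\<Sum>b\<in>?I. \<Sum>e\<in>{e. e dvd d}. if int e dvd b then real_of_int (moebius_mu e) * F b else 0)"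
  proof (rule sum.cong)
    fix b
    show "real_of_int (if coprime b (int d) then 1 else 0) * F b =
      (\<Sum>e\<in>{e. e dvd d}. if int e dvd b then real_of_int (moebius_mu e) * F b else 0)"
      unfolding sum_moebius_mu_coprime[OF assms(1), symmetric]
      using fin by (simp add: sum.If_cases sum_distrib_right Int_def)
  qed simp
  also have "\<dots> = (\<Sum>e\<in>{e. e dvd d}. \<Sum>b\<in>?I. if int e dvd b then real_of_int (moebius_mu e) * F b else 0)"
    by (rule sum.swap)
  also have "\<dots> = (\<Sum>e\<in>{e. e dvd d}. real_of_int (moebius_mu e) *
      (\<Sum>b=1..int (d div e * k) - 1. F (int e * b)))"
  proof (rule sum.cong)
    fix e assume "e \<in> {e. e dvd d}"
    then obtain \<delta> where \<delta>: "d = e * \<delta>" by auto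
    with d0 have e0: "e > 0" by (auto intro: Nat.gr0I)
    have "(\<Sum>b\<in>?I. if int e dvd b then real_of_int (moebius_mu e) * F b else 0) =
        (\<Sum>b | b \<in> ?I \<and> int e dvd b. real_of_int (moebius_mu e) * F b)"
      by (intro sum.mono_neutral_cong_right) auto
    also have "\<dots> = (\<Sum>b=1..int (\<delta> * k) - 1. real_of_int (moebius_mu e) * F (int e * b))"
    proof (rule sum.reindex_bij_witness[of _ "\<lambda>b. int e * b" "\<lambda>b. b div int e"])
      fix b assume b: "b \<in> {b. b \<in> ?I \<and> int e dvd b}"
      then obtain c where c: "b = int e * c" by auto
      moreover have "1 \<le> b" "b < int e * (int \<delta> * int k)" using b by (simp_all add: \<delta>)
      ultimately have "1 \<le> int e * c" "int e * c < int e * (int \<delta> * int k)" by simp_all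
      then have "c < int \<delta> * int k" "0 < c"
        using e0 by (simp_all add: zero_less_mult_iff int_one_le_iff_zero_less)
      with c e0 show "int e * (b div int e) = b" "b div int e \<in> {1..int (\<delta> * k) - 1}"
        "real_of_int (moebius_mu e) * F (int e * (b div int e)) = real_of_int (moebius_mu e) * F b" by auto
    next
      fix b assume "b \<in> {1..int (\<delta> * k) - 1}"
      then have "1 \<le> b" "b < int (\<delta> * k)" by auto
      then have "int e * b < int e * int (\<delta> * k)" "int e * b \<ge> 1"
        using e0 by (simp_all del: of_nat_mult add: int_one_le_iff_zero_less)
      then show "int e * b \<in> {b. b \<in> ?I \<and> int e dvd b}" by (simp add: \<delta> algebra_simps)
    qed (use e0 in simp)
    finally show "(\<Sum>b\<in>?I. if int e dvd b then real_of_int (moebius_mu e) * F b else 0) =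
      real_of_int (moebius_mu e) * (\<Sum>b=1..int (d div e * k) - 1. F (int e * b))"
      using e0 by (simp add: \<delta> sum_distrib_left)
  qed simp
  \<comment> \<open>Passage from \<open>e\<close> to the complementary divisor
    \<open>\<delta> = d div e\<close>.\<close>
  also have "\<dots> = (\<Sum>\<delta> | \<delta> dvd d. real_of_int (moebius_mu (d div \<delta>)) *
      (\<Sum>b=1..int (\<delta> * k) - 1. F (int (d div \<delta>) * b)))"
    by (rule sum.reindex_bij_witness[of _ "\<lambda>e. d div e" "\<lambda>e. d div e"])
      (use d0 in \<open>auto elim!: dvdE simp: div_mult2_eq\<close>)
  finally show ?thesis .
qed

text \<open>In the sieve, the factor \<open>d div \<delta>\<close> of the argument cancels against
  the denominator \<open>d * k\<close>, so each inner sum is \<open>4 * \<delta> * k\<close> times a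
  Dedekind sum of modulus \<open>\<delta> * k\<close>.\<close>

lemma sum_cot_coprime:
  assumes "squarefree d" "k > 0"
  shows "(\<Sum>b | b \<in> {1..int (d * k) - 1} \<and> coprime b (int d).
      cot (pi * real_of_int b / real (d * k)) * cot (pi * real_of_int b * real_of_int h / real (d * k))) =
    4 * real k * (\<Sum>\<delta> | \<delta> dvd d. real_of_int (moebius_mu (d div \<delta>)) * real \<delta> * dedekind_sum h (int (\<delta> * k)))"
  unfolding sum_coprime_sieve[OF assms] sum_distrib_left[of "4 * real k"]
proof (rule sum.cong)
  fix \<delta> assume "\<delta> \<in> {\<delta>. \<delta> dvd d}"
  then obtain e where e: "d = \<delta> * e" by auto
  have "d > 0" using assms by (metis not_squarefree_0 gr0I)
  with e have pos: "\<delta> > 0" "e > 0" by auto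
  have cancel: "pi * real_of_int (int e * b) / real (d * k) = pi * real_of_int b / real_of_int (int (\<delta> * k))"
    "pi * real_of_int (int e * b) * real_of_int h / real (d * k) =
      pi * real_of_int b * real_of_int h / real_of_int (int (\<delta> * k))" for b
    using pos by (simp_all add: e field_simps)
  have "(\<Sum>b=1..int (\<delta> * k) - 1. cot (pi * real_of_int (int e * b) / real (d * k)) *
          cot (pi * real_of_int (int e * b) * real_of_int h / real (d * k)))
      = 4 * real (\<delta> * k) * dedekind_sum h (int (\<delta> * k))"
    unfolding cancel dedekind_sum_def using pos assms(2) by (simp add: sum_distrib_left)
  then show "real_of_int (moebius_mu (d div \<delta>)) *
      (\<Sum>b = 1..int (\<delta> * k) - 1. cot (pi * real_of_int (int (d div \<delta>) * b) / real (d * k)) *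
          cot (pi * real_of_int (int (d div \<delta>) * b) * real_of_int h / real (d * k))) =
    4 * real k * (real_of_int (moebius_mu (d div \<delta>)) * real \<delta> * dedekind_sum h (int (\<delta> * k)))"
    using pos e by (simp add: mult.assoc)
qed simp

section \<open>Rationality of Dedekind sums\<close>

text \<open>Euler's formulas, after taking the factor \<open>cis (t / 2)\<close> out of
  \<open>cis t + 1\<close> and \<open>cis t - 1\<close>.\<close>

lemma cot_half_cis:
  assumes "cis t \<noteq> 1"
  shows "complex_of_real (cot (t / 2)) = \<i> * (cis t + 1) / (cis t - 1)"
proof -
  let ?w = "cis (t / 2)"
  have t: "cis t = ?w * ?w" by (simp add: cis_mult)
  have inv: "?w * cis (- (t / 2)) = 1" by (simp add: cis_mult)
  have c: "cis t + 1 = ?w * (2 * of_real (cos (t / 2)))"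
    using inv unfolding t by (simp add: complex_eq_iff algebra_simps)
  have s: "cis t - 1 = ?w * (2 * \<i> * of_real (sin (t / 2)))"
    using inv unfolding t by (simp add: complex_eq_iff algebra_simps)
  with assms have "sin (t / 2) \<noteq> 0" by auto
  then show ?thesis unfolding c s by (simp add: cot_def field_simps)
qed

lemma cis_root_power_neq_1:
  assumes "d > 0" "\<not> d dvd n"
  shows "cis (2 * pi / real d) ^ n \<noteq> 1"
proof
  assume "cis (2 * pi / real d) ^ n = 1"
  then have "exp (\<i> * of_real (real n * (2 * pi / real d))) = 1"
    unfolding cis_conv_exp[symmetric] by (simp add: Complex.DeMoivre)
  then obtain k where "real n * (2 * pi / real d) = real_of_int (2 * k) * pi"
    unfolding exp_eq_1 by auto
  then have "real n = real_of_int (k * int d)" using assms(1) by (simp add: field_simps)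
  then have "int n = k * int d" by (metis of_int_eq_iff of_int_of_nat_eq)
  then show False using assms(2) by (metis dvd_triv_right int_dvd_int_iff)
qed

text \<open>Multiplying the sum of \<open>r * w ^ r\<close> by \<open>w - 1\<close> telescopes up to
  a geometric sum, which vanishes over a full period of the root of unity. The inverse thus becomes
  a polynomial in \<open>w\<close> with rational coefficients.\<close>

lemma inverse_root_of_unity_minus_1:
  fixes w :: complex
  assumes "w ^ d = 1" "w \<noteq> 1" "d > 0"
  shows "1 / (w - 1) = (\<Sum>r<d. of_nat r * w ^ r) / of_nat d"
proof -
  have "(w - 1) * (\<Sum>r<n. of_nat r * w ^ r) + (\<Sum>r<n. w ^ r) * w = of_nat n * w ^ n" for n
    by (induction n) (simp_all add: algebra_simps)
  from this[of d] have "(w - 1) * (\<Sum>r<d. of_nat r * w ^ r) = of_nat d"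
    using assms by (simp add: sum_gp_strict)
  then show ?thesis using assms by (simp add: field_simps)
qed

lemma of_real_of_rat: "of_real (of_rat q) = (of_rat q :: 'a :: real_field)"
  by (cases q) (simp add: of_rat_rat)

text \<open>
  Each \<open>cot(\<pi>n/d)\<close> is \<open>\<i>\<close> times a rational combination of powers of \<open>w\<^sup>n\<close> with
  \<open>w = exp(2\<pi>\<i>/d)\<close>, and the sums of \<open>w\<^bsup>jn\<^esup>\<close> over \<open>1 \<le> n < d\<close> are rational.
\<close>

lemma dedekind_sum_rational:
  assumes "d > 0" "coprime c d"
  shows "dedekind_sum (int c) (int d) \<in> \<rat>"
proof -
  define w where "w = cis (2 * pi / real d)"
  \<comment> \<open>\<open>a r\<close> is the coefficient of \<open>u ^ r\<close> in the expansion
    of \<open>1 + 2 / (u - 1)\<close> for a \<open>d\<close>-th root of unity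
    \<open>u \<noteq> 1\<close>: the constant goes to \<open>r = 0\<close>, the rest comes from
    \<open>inverse_root_of_unity_minus_1\<close>.\<close>
  define a where "a r = (if r = 0 then 1 else 0) + 2 * of_nat r / (of_nat d :: complex)" for r
  have a: "a r \<in> \<rat>" for r by (auto simp: a_def)
  have wd: "w ^ d = 1" using assms(1) by (simp add: w_def Complex.DeMoivre)
  have wcis: "w ^ n = cis (2 * (pi * real n / real d))" for n
    by (simp add: w_def Complex.DeMoivre algebra_simps)
  have w1: "w ^ n \<noteq> 1" if "\<not> d dvd n" for n
    using cis_root_power_neq_1[OF assms(1) that] by (simp add: w_def)
  have cotw: "complex_of_real (cot (pi * real n / real d)) = \<i> * (\<Sum>r<d. a r * (w ^ n) ^ r)"
    if "\<not> d dvd n" for n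
  proof -
    let ?u = "w ^ n"
    have u: "?u ^ d = 1" by (metis wd mult.commute power_mult power_one)
    have u1: "?u - 1 \<noteq> 0" using w1[OF that] by simp
    have "complex_of_real (cot (pi * real n / real d)) = \<i> * (?u + 1) / (?u - 1)"
      using cot_half_cis[of "2 * (pi * real n / real d)"] w1[OF that] by (simp add: wcis)
    also have "\<dots> = \<i> * (1 + 2 * (1 / (?u - 1)))" using u1 by (simp add: field_simps)
    also have "\<dots> = \<i> * (\<Sum>r<d. a r * ?u ^ r)"
      unfolding inverse_root_of_unity_minus_1[OF u w1[OF that] assms(1)]
      using assms(1) by (simp add: a_def sum.distrib distrib_right sum_distrib_left sum_divide_distrib
          if_distrib[of "\<lambda>x. x * _"] sum.delta cong: if_cong) (simp add: algebra_simps)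
    finally show ?thesis .
  qed
  have i_mult: "\<i> * x * (\<i> * y) = - (x * y)" for x y :: complex
    by (simp add: complex_eq_iff algebra_simps)
  have power_sum: "(\<Sum>n=1..<d. (w ^ j) ^ n) \<in> \<rat>" for j
  proof -
    have "(\<Sum>n<d. (w ^ j) ^ n) \<in> \<rat>"
    proof (cases "w ^ j = 1")
      case False
      have "(w ^ j) ^ d = 1" by (metis wd mult.commute power_mult power_one)
      with False show ?thesis by (simp add: sum_gp_strict)
    qed simp
    moreover have "(\<Sum>n<d. (w ^ j) ^ n) = 1 + (\<Sum>n=1..<d. (w ^ j) ^ n)"
      using assms(1) by (simp add: lessThan_atLeast0 sum.atLeast_Suc_lessThan)
    ultimately show ?thesis by (metis Rats_diff Rats_1 add_diff_cancel_left')
  qed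
  have "complex_of_real (\<Sum>n=1..<d. cot (pi * real n / real d) * cot (pi * real (n * c) / real d)) =
      (\<Sum>n=1..<d. - ((\<Sum>r<d. a r * (w ^ n) ^ r) * (\<Sum>s<d. a s * (w ^ (n * c)) ^ s)))"
    unfolding of_real_sum
  proof (rule sum.cong)
    fix n assume n: "n \<in> {1..<d}"
    then have nd: "\<not> d dvd n" by (auto dest: dvd_imp_le)
    \<comment> \<open>Coprimality of \<open>c\<close> and \<open>d\<close> keeps the second
      cotangent away from its poles, so the same expansion applies to it.\<close>
    then have nc: "\<not> d dvd n * c"
      using assms(2) by (simp add: coprime_dvd_mult_left_iff coprime_commute)
    show "complex_of_real (cot (pi * real n / real d) * cot (pi * real (n * c) / real d)) =
        - ((\<Sum>r<d. a r * (w ^ n) ^ r) * (\<Sum>s<d. a s * (w ^ (n * c)) ^ s))"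
      unfolding of_real_mult cotw[OF nd] cotw[OF nc] i_mult ..
  qed simp
  \<comment> \<open>After expanding the product, \<open>w\<close> has the exponent
    \<open>n * (r + c * s)\<close>; summing over \<open>n\<close> first leaves only rational power
    sums.\<close>
  also have "\<dots> = - (\<Sum>r<d. \<Sum>s<d. a r * a s * (\<Sum>n=1..<d. (w ^ (r + c * s)) ^ n))"
  proof -
    have "(\<Sum>r<d. a r * (w ^ n) ^ r) * (\<Sum>s<d. a s * (w ^ (n * c)) ^ s) =
        (\<Sum>r<d. \<Sum>s<d. a r * a s * (w ^ (r + c * s)) ^ n)" for n
      unfolding sum_product
      by (intro sum.cong refl) (simp add: power_add power_mult_distrib mult_ac flip: power_mult)
    then show ?thesis
      by (simp add: sum_negf sum_distrib_left sum.swap[of _ _ "{Suc 0..<d}"])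
  qed
  also have "\<dots> \<in> \<rat>" by (intro Rats_minus_iff[THEN iffD2] Rats_sum Rats_mult a power_sum)
  finally obtain q where "complex_of_real (\<Sum>n=1..<d. cot (pi * real n / real d) * cot (pi * real (n * c) / real d)) = of_rat q"
    by (rule Rats_cases)
  then have "complex_of_real (\<Sum>n=1..<d. cot (pi * real n / real d) * cot (pi * real (n * c) / real d)) = of_real (of_rat q)"
    by (simp add: of_real_of_rat)
  then have "(\<Sum>n=1..<d. cot (pi * real n / real d) * cot (pi * real (n * c) / real d)) \<in> \<rat>"
    unfolding of_real_eq_iff by simp
  moreover have "(\<Sum>n=1..\<bar>int d\<bar> - 1. cot (pi * real_of_int n / real_of_int (int d)) *
      cot (pi * real_of_int n * real_of_int (int c) / real_of_int (int d))) =
      (\<Sum>n=1..<d. cot (pi * real n / real d) * cot (pi * real (n * c) / real d))"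
    by (rule sum.reindex_bij_witness[of _ int nat]) (auto simp: mult.assoc)
  ultimately show ?thesis unfolding dedekind_sum_def by simp
qed

section \<open>Odd characters trivial on a subgroup of odd order\<close>

text \<open>Multiplication by a primitive \<open>n\<close>-th root of unity permutes the solutions
  of \<open>z ^ n = c\<close> and multiplies the sum by a factor different from 1.\<close>

lemma sum_power_roots:
  fixes c :: complex
  assumes "n > 0" "\<not> n dvd j"
  shows "(\<Sum>z | z ^ n = c. z ^ j) = 0"
proof -
  define w where "w = cis (2 * pi / real n)"
  have w: "w ^ n = 1" "w ^ j \<noteq> 1" "w \<noteq> 0"
    using assms cis_root_power_neq_1[OF assms] by (simp_all add: w_def Complex.DeMoivre)
  have "(\<Sum>z | z ^ n = c. z ^ j) = (\<Sum>z | z ^ n = c. (w * z) ^ j)"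
    by (rule sum.reindex_bij_witness[of _ "\<lambda>z. w * z" "\<lambda>z. z / w"])
      (use w in \<open>auto simp: power_mult_distrib power_divide\<close>)
  also have "\<dots> = w ^ j * (\<Sum>z | z ^ n = c. z ^ j)"
    by (simp add: power_mult_distrib sum_distrib_left)
  finally show ?thesis using w by simp
qed

lemma dirichlet_character_cong:
  assumes "dirichlet_character m \<psi>" "[a = b] (mod int m)"
  shows "\<psi> a = \<psi> b"
proof -
  obtain k where "b = a + int m * k" using assms(2) by (auto simp: cong_iff_lin)
  then show ?thesis
    using assms(1) periodic_int_mult[of \<psi> m a k] by (simp add: dirichlet_character_def)
qed

lemma dirichlet_character_1:
  assumes "dirichlet_character m \<psi>"
  shows "\<psi> 1 = 1"
proof -
  have "\<psi> (1 * 1) = \<psi> 1 * \<psi> 1"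
    using assms unfolding dirichlet_character_def by blast
  moreover have "\<psi> 1 \<noteq> 0" using assms by (simp add: dirichlet_character_def)
  ultimately show ?thesis by simp
qed

lemma dirichlet_character_power:
  assumes "dirichlet_character m \<psi>"
  shows "\<psi> (a ^ n) = \<psi> a ^ n"
proof (induction n)
  case (Suc n)
  then show ?case using assms by (simp add: dirichlet_character_def)
qed (simp add: dirichlet_character_1[OF assms])

text \<open>By Euler's theorem the values at units are roots of unity.\<close>

lemma norm_dirichlet_character:
  assumes "dirichlet_character m \<psi>" "m > 1" "coprime a (int m)"
  shows "cmod (\<psi> a) = 1"
proof -
  interpret residues "int m" "residue_ring (int m)"
    using assms(2) by unfold_locales simp_all
  have "[a ^ totient m = 1] (mod int m)"
    using euler_theorem[OF assms(3)] by simp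
  then have "\<psi> a ^ totient m = 1"
    using dirichlet_character_cong[OF assms(1)] dirichlet_character_power[OF assms(1)]
      dirichlet_character_1[OF assms(1)] by metis
  then have "cmod (\<psi> a) ^ totient m = 1" by (metis norm_one norm_power)
  then show ?thesis using assms(2) power_eq_1_iff[of "cmod (\<psi> a)" "totient m"] by simp
qed

text \<open>In the cyclic unit group modulo \<open>p\<close>, odd order of \<open>H\<close> amounts
  to -1 not being in \<open>H\<close>, so that odd characters trivial on \<open>H\<close>
  exist.\<close>

locale odd_order_subgroup =
  fixes p :: nat and H :: "int set"
  assumes prime: "prime p" and ge3: "p \<ge> 3"
    and subgroup: "subgroup H (unit_group_mod p)" and odd_card: "odd (card H)"
begin

lemma subset_units_mod: "H \<subseteq> units_mod p"
  using subgroup.subset[OF subgroup] carrier_unit_group_mod ge3 by simp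

lemma card_pos: "card H > 0"
  using odd_card by (rule odd_pos)

text \<open>As \<open>(\<int>/p\<int>)\<^sup>*\<close> is cyclic, a subgroup is determined by its order.\<close>

lemma mem_iff:
  assumes "coprime a (int p)"
  shows "a mod int p \<in> H \<longleftrightarrow> [a ^ card H = 1] (mod int p)"
proof -
  interpret R: residues_prime p "residue_ring (int p)"
    using prime by unfold_locales
  interpret G: group "unit_group_mod p" by (rule R.units_group)
  \<comment> \<open>\<open>S\<close> consists of the roots of a polynomial of degree
    \<open>card H\<close> over a field, so it has at most \<open>card H\<close> elements; it
    contains \<open>H\<close> because every element of a finite group is killed by the group
    order.\<close>
  define S where "S = {x \<in> carrier (residue_ring (int p)).
    x [^]\<^bsub>residue_ring (int p)\<^esub> card H = \<one>\<^bsub>residue_ring (int p)\<^esub>}"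
  have "card S \<le> card H"
    unfolding S_def by (rule R.num_roots_le_deg) (use card_pos in auto)
  moreover have "H \<subseteq> S"
  proof
    fix x assume x: "x \<in> H"
    interpret K: group "unit_group_mod p\<lparr>carrier := H\<rparr>"
      using subgroup.subgroup_is_group[OF subgroup] by simp
    have "x [^]\<^bsub>unit_group_mod p\<^esub> card H = \<one>\<^bsub>unit_group_mod p\<^esub>"
      using K.pow_order_eq_1[of x] x by (simp add: order_def flip: G.nat_pow_consistent)
    moreover have "x \<in> Units (residue_ring (int p))"
      using x subgroup.subset[OF subgroup] by (auto simp: units_of_carrier)
    ultimately show "x \<in> S"
      using R.Units_closed by (simp add: S_def R.units_of_pow units_of_one)
  qed
  moreover have "finite S" by (simp add: S_def)
  ultimately have "H = S" by (intro card_subset_eq) (auto intro!: antisym card_mono)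
  then have "a mod int p \<in> H \<longleftrightarrow> a mod int p \<in> S" by simp
  also have "\<dots> \<longleftrightarrow> [a ^ card H = 1] (mod int p)"
    by (simp add: S_def R.pow_cong R.one_cong cong_def)
  finally show ?thesis .
qed

section \<open>Discrete logarithms to a primitive root\<close>

definition gen :: nat where "gen = (SOME g. residue_primroot p g)"

lemma residue_primroot_gen: "residue_primroot p gen"
  unfolding gen_def by (rule someI_ex) (use prime_primitive_root_exists[OF _ prime] ge3 in auto)

lemma gen_power_cong_iff: "[int gen ^ i = int gen ^ j] (mod int p) \<longleftrightarrow> [i = j] (mod (p - Suc 0))"
proof -
  have "[int gen ^ i = int gen ^ j] (mod int p) \<longleftrightarrow> [gen ^ i = gen ^ j] (mod p)"
    by (simp flip: of_nat_power add: cong_int_iff)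
  then show ?thesis
    using residue_primroot_gen order_divides_expdiff[of p gen] prime
    by (simp add: residue_primroot_def totient_prime)
qed

lemma gen_power_cong_1_iff: "[int gen ^ i = 1] (mod int p) \<longleftrightarrow> p - Suc 0 dvd i"
  using gen_power_cong_iff[of i 0] by (simp add: cong_0_iff)

lemma coprime_gen_power: "coprime (int gen ^ i) (int p)"
  using residue_primroot_gen by (simp add: residue_primroot_def coprime_commute)

text \<open>Some exponent is chosen, determined only modulo \<open>p - 1\<close>; whatever is built
  on it must respect that congruence.\<close>

definition dlog :: "int \<Rightarrow> nat" where "dlog a = (SOME i. [a = int gen ^ i] (mod int p))"

lemma dlog:
  assumes "coprime a (int p)"
  shows "[a = int gen ^ dlog a] (mod int p)"
proof -
  have "nat (a mod int p) \<in> totatives p"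
  proof -
    have "a mod int p \<noteq> 0" using assms ge3 by (auto simp: dvd_eq_mod_eq_0[symmetric])
    moreover have "coprime (a mod int p) (int p)" using assms ge3 by simp
    ultimately show ?thesis
      using ge3 by (simp add: in_totatives_iff nat_le_iff less_imp_le order.not_eq_order_implies_strict
          flip: coprime_int_iff)
  qed
  then obtain i where "nat (a mod int p) = gen ^ i mod p"
    using residue_primroot_is_generator[OF _ residue_primroot_gen] ge3
    by (auto simp: bij_betw_def)
  moreover have "int (nat (a mod int p)) = a mod int p" using ge3 by simp
  ultimately have "a mod int p = int (gen ^ i mod p)" by simp
  then have "[a = int gen ^ i] (mod int p)" by (simp add: cong_def zmod_int)
  then show ?thesis unfolding dlog_def by (rule someI)
qed

lemma dlog_cong_iff:
  assumes "coprime a (int p)"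
  shows "[a = int gen ^ i] (mod int p) \<longleftrightarrow> [dlog a = i] (mod (p - Suc 0))"
  using dlog[OF assms] gen_power_cong_iff[of "dlog a" i] by (simp add: cong_def)

text \<open>Half the index of \<open>H\<close> in the unit group; the division is exact by
  \<open>card_units\<close>. It turns out to be the number of odd characters trivial on
  \<open>H\<close>.\<close>

definition half_index :: nat where "half_index = (p - Suc 0) div (2 * card H)"

text \<open>\<open>card H\<close> divides \<open>p - 1\<close> by Lagrange and so does 2; the two
  are coprime because \<open>card H\<close> is odd.\<close>

lemma card_units: "p - Suc 0 = 2 * card H * half_index"
proof -
  interpret R: residues_prime p "residue_ring (int p)"
    using prime by unfold_locales
  interpret G: group "unit_group_mod p" by (rule R.units_group)
  have "card H dvd order (unit_group_mod p)"
    using G.lagrange[OF subgroup] by (metis dvd_triv_right)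
  moreover have "order (unit_group_mod p) = p - Suc 0"
    using carrier_unit_group_mod[of p] ge3 prime by (simp add: order_def card_units_mod totient_prime)
  moreover have "even (p - Suc 0)" using prime ge3 by (simp add: prime_odd_nat)
  ultimately have "2 * card H dvd p - Suc 0"
    using odd_card by (intro divides_mult) (auto simp: coprime_commute)
  then show ?thesis by (simp add: half_index_def)
qed

lemma half_index_pos: "half_index > 0"
proof (rule Nat.gr0I)
  assume "half_index = 0"
  then have "p - Suc 0 = 0" by (simp only: card_units mult_0_right)
  then show False using ge3 by simp
qed

text \<open>\<open>H\<close> is generated by the power of \<open>gen\<close> with exponent
  \<open>2 * half_index\<close>: this rewrites the criterion \<open>mem_iff\<close> in terms of
  exponents.\<close>

lemma mem_iff_dlog:
  assumes "coprime a (int p)"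
  shows "a mod int p \<in> H \<longleftrightarrow> 2 * half_index dvd dlog a"
proof -
  have "[a ^ card H = (int gen ^ dlog a) ^ card H] (mod int p)"
    using dlog[OF assms] by (rule cong_pow)
  then have c: "[a ^ card H = int gen ^ (dlog a * card H)] (mod int p)"
    by (simp add: power_mult)
  have "[a ^ card H = 1] (mod int p) \<longleftrightarrow> [int gen ^ (dlog a * card H) = 1] (mod int p)"
    using c by (simp add: cong_def)
  then show ?thesis
    using card_pos by (simp add: mem_iff[OF assms] gen_power_cong_1_iff card_units mult.commute mult.left_commute)
qed

text \<open>Since -1 has square 1, its exponent is a multiple of \<open>card H * half_index\<close>.
  An even quotient by \<open>half_index\<close> would, \<open>card H\<close> being odd, make the
  exponent a multiple of \<open>p - 1\<close> and hence -1 congruent to 1.\<close>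

lemma dlog_minus_1: "half_index dvd dlog (- 1)" "odd (dlog (- 1) div half_index)"
proof -
  let ?i = "dlog (- 1)"
  have i: "[- 1 = int gen ^ ?i] (mod int p)" by (rule dlog) simp
  have "[(- 1) ^ 2 = (int gen ^ ?i) ^ 2] (mod int p)" using i by (rule cong_pow)
  then have "[int gen ^ (?i * 2) = 1] (mod int p)" by (simp add: power_mult cong_sym)
  then have "2 * (card H * half_index) dvd 2 * ?i"
    unfolding gen_power_cong_1_iff card_units by (simp add: mult_ac)
  then have d: "card H * half_index dvd ?i" by simp
  then show 1: "half_index dvd ?i" by (rule dvd_mult_right)
  show "odd (?i div half_index)"
  proof
    assume "even (?i div half_index)"
    moreover have "card H dvd ?i div half_index"
      using d half_index_pos by (auto elim!: dvdE simp: mult.assoc)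
    ultimately have "2 * card H dvd ?i div half_index"
      using odd_card by (intro divides_mult) (auto simp: coprime_commute)
    then have "2 * card H * half_index dvd ?i div half_index * half_index"
      by (rule mult_dvd_mono) simp
    then have "2 * card H * half_index dvd ?i" using 1 by simp
    then have "[int gen ^ ?i = 1] (mod int p)" by (simp add: gen_power_cong_1_iff card_units)
    with i have "[- 1 = 1] (mod int p)" by (rule cong_trans)
    then have "int p dvd 2" by (simp add: cong_iff_dvd_diff)
    then show False using ge3 by (auto dest: zdvd_imp_le)
  qed
qed

section \<open>Odd characters parametrised by roots of -1\<close>

text \<open>Intended as the character with value \<open>z\<close> at \<open>gen\<close>. It is one
  only for suitable \<open>z\<close>, such as those with
  \<open>z ^ half_index = - 1\<close>.\<close>

definition char_of :: "complex \<Rightarrow> int \<Rightarrow> complex" where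
  "char_of z a = (if coprime a (int p) then z ^ dlog a else 0)"

text \<open>Such a \<open>z\<close> satisfies \<open>z ^ (p - 1) = 1\<close>, because
  \<open>p - 1\<close> is an even multiple of \<open>half_index\<close>. Hence
  \<open>char_of z\<close> does not depend on the exponent chosen by \<open>dlog\<close>.\<close>

lemma power_cong_mod:
  fixes z :: complex
  assumes "z ^ half_index = - 1" "[i = j] (mod (p - Suc 0))"
  shows "z ^ i = z ^ j"
proof -
  have order: "p - Suc 0 = half_index * (2 * card H)"
    by (rule trans[OF card_units mult.commute])
  have "z ^ (p - Suc 0) = (z ^ half_index) ^ (2 * card H)"
    by (subst order, rule power_mult)
  then have 1: "z ^ (p - Suc 0) = 1" by (simp add: assms(1))
  have "z ^ i = z ^ (i mod (p - Suc 0))" for i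
  proof -
    have "z ^ i = z ^ ((p - Suc 0) * (i div (p - Suc 0)) + i mod (p - Suc 0))" by simp
    also have "\<dots> = z ^ (i mod (p - Suc 0))"
      by (simp only: power_add power_mult 1 power_one mult_1_left)
    finally show ?thesis .
  qed
  from this[of i] this[of j] show ?thesis using assms(2) by (simp add: cong_def)
qed

text \<open>The exponent of -1 is an odd multiple of \<open>half_index\<close>, which gives the
  value -1 there; exponents of elements of \<open>H\<close> are even multiples, which gives the
  value 1.\<close>

lemma char_of_in_odd_characters:
  assumes z: "z ^ half_index = - 1"
  shows "char_of z \<in> odd_characters p H"
proof -
  have mult: "char_of z (a * b) = char_of z a * char_of z b" for a b
  proof (cases "coprime a (int p) \<and> coprime b (int p)")
    case True
    then have "[a * b = int gen ^ (dlog a + dlog b)] (mod int p)"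
      using dlog by (simp add: power_add cong_mult)
    then have "[dlog (a * b) = dlog a + dlog b] (mod (p - Suc 0))"
      using True by (subst (asm) dlog_cong_iff) auto
    then show ?thesis
      using True power_cong_mod[OF z] by (simp add: char_of_def power_add)
  qed (auto simp: char_of_def)
  have per: "char_of z (a + int p) = char_of z a" for a
  proof (cases "coprime a (int p)")
    case True
    then have cop: "coprime (a + int p) (int p)" by (simp add: coprime_iff_gcd_eq_1)
    have "[a + int p = int gen ^ dlog a] (mod int p)"
      using dlog[OF True] by (simp add: cong_def)
    then show ?thesis
      using True cop power_cong_mod[OF z] by (simp add: dlog_cong_iff char_of_def)
  qed (simp add: char_of_def coprime_iff_gcd_eq_1)
  have "z \<noteq> 0" using z half_index_pos by (auto simp: power_0_left)
  then have dir: "dirichlet_character p (char_of z)"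
    using mult per by (auto simp: dirichlet_character_def char_of_def)
  have "char_of z (- 1) = (z ^ half_index) ^ (dlog (- 1) div half_index)"
    using dlog_minus_1(1) by (simp add: char_of_def flip: power_mult)
  then have m1: "char_of z (- 1) = - 1" using dlog_minus_1(2) by (simp add: z)
  have "char_of z h = 1" if h: "h \<in> H" for h
  proof -
    have hu: "coprime h (int p)" "h mod int p = h" using h subset_units_mod by (auto simp: units_mod_def)
    then obtain t where "dlog h = 2 * half_index * t" using mem_iff_dlog[of h] h by auto
    then have "z ^ dlog h = (z ^ half_index) ^ (2 * t)"
      by (simp only: mult_ac flip: power_mult)
    then show ?thesis using hu z by (simp add: char_of_def)
  qed
  with dir m1 show ?thesis by (simp add: odd_characters_def)
qed

text \<open>A character is determined by its value at \<open>gen\<close>. Triviality on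
  \<open>H\<close> makes the \<open>half_index\<close>-th power of this value a square root of 1,
  and oddness selects -1.\<close>

lemma odd_characters_eq_image: "odd_characters p H = char_of ` {z. z ^ half_index = - 1}"
proof (intro equalityI subsetI)
  fix \<psi> assume \<psi>: "\<psi> \<in> odd_characters p H"
  then have dir: "dirichlet_character p \<psi>" and m1: "\<psi> (- 1) = - 1" and triv: "\<And>h. h \<in> H \<Longrightarrow> \<psi> h = 1"
    by (auto simp: odd_characters_def)
  let ?z = "\<psi> (int gen)"
  have eval: "\<psi> a = ?z ^ dlog a" if "coprime a (int p)" for a
    using dirichlet_character_cong[OF dir dlog[OF that]] dirichlet_character_power[OF dir] by simp
  \<comment> \<open>The exponent is known modulo \<open>p - 1\<close> only; this suffices since
    \<open>2 * half_index\<close> divides \<open>p - 1\<close>.\<close>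
  have "[dlog (int gen ^ (2 * half_index)) = 2 * half_index] (mod (p - Suc 0))"
    using dlog_cong_iff[OF coprime_gen_power, of "2 * half_index" "2 * half_index"] by simp
  then have "[dlog (int gen ^ (2 * half_index)) = 2 * half_index] (mod (2 * half_index))"
    by (rule cong_dvd_modulus_nat) (simp add: card_units)
  then have "2 * half_index dvd dlog (int gen ^ (2 * half_index))"
    by (simp add: cong_def dvd_eq_mod_eq_0)
  then have "int gen ^ (2 * half_index) mod int p \<in> H"
    by (simp add: mem_iff_dlog[OF coprime_gen_power])
  then have "\<psi> (int gen ^ (2 * half_index) mod int p) = 1" by (rule triv)
  then have "\<psi> (int gen ^ (2 * half_index)) = 1"
    using dirichlet_character_cong[OF dir, of "int gen ^ (2 * half_index) mod int p" "int gen ^ (2 * half_index)"]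
    by (simp add: cong_def)
  then have "(?z ^ half_index)\<^sup>2 = 1"
    by (simp only: dirichlet_character_power[OF dir] power_mult[of ?z half_index 2, symmetric] mult.commute)
  \<comment> \<open>Otherwise \<open>\<psi> (- 1)\<close>, which is a power of
    \<open>?z ^ half_index\<close>, would be 1.\<close>
  moreover have "?z ^ half_index \<noteq> 1"
  proof
    assume "?z ^ half_index = 1"
    then have "(?z ^ half_index) ^ (dlog (- 1) div half_index) = 1" by simp
    then have "?z ^ dlog (- 1) = 1" using dlog_minus_1(1) unfolding power_mult[symmetric] by simp
    then show False using eval[of "- 1"] m1 by simp
  qed
  ultimately have "?z ^ half_index = - 1" by (simp add: power2_eq_1_iff)
  moreover have "\<psi> = char_of ?z"
  proof
    fix a
    show "\<psi> a = char_of ?z a"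
      using eval[of a] dir by (auto simp: char_of_def dirichlet_character_def)
  qed
  ultimately show "\<psi> \<in> char_of ` {z. z ^ half_index = - 1}" by blast
qed (auto intro: char_of_in_odd_characters)

text \<open>The parameter is recovered as the value at \<open>gen\<close>.\<close>

lemma inj_on_char_of: "inj_on char_of {z. z ^ half_index = - 1}"
proof (rule inj_onI)
  have cop: "coprime (int gen) (int p)" using coprime_gen_power[of 1] by simp
  have "[dlog (int gen) = 1] (mod (p - Suc 0))" using dlog_cong_iff[OF cop, of 1] by simp
  then have gen: "char_of z (int gen) = z" if "z ^ half_index = - 1" for z
    using power_cong_mod[OF that, of "dlog (int gen)" 1] cop by (simp add: char_of_def)
  fix x y assume xy: "x \<in> {z. z ^ half_index = - 1}" "y \<in> {z. z ^ half_index = - 1}"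
    and eq: "char_of x = char_of y"
  have "x = char_of x (int gen)" using xy(1) by (intro gen[symmetric]) simp
  also have "\<dots> = char_of y (int gen)" by (simp only: eq)
  also have "\<dots> = y" using xy(2) by (intro gen) simp
  finally show "x = y" .
qed

lemma card_odd_characters: "card (odd_characters p H) = half_index"
  unfolding odd_characters_eq_image card_image[OF inj_on_char_of]
  by (rule card_nth_roots) (simp_all add: half_index_pos)

lemma odd_character_mem:
  assumes "\<psi> \<in> odd_characters p H" "a mod int p \<in> H"
  shows "\<psi> a = 1"
proof -
  have "\<psi> a = \<psi> (a mod int p)"
    using assms(1) dirichlet_character_cong[of p \<psi> a "a mod int p"]
    by (simp add: odd_characters_def cong_def)
  with assms show ?thesis by (simp add: odd_characters_def)
qed

lemma odd_character_minus:
  assumes "\<psi> \<in> odd_characters p H"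
  shows "\<psi> (- a) = - \<psi> a"
proof -
  have "\<psi> (- 1 * a) = \<psi> (- 1) * \<psi> a"
    using assms unfolding odd_characters_def dirichlet_character_def by blast
  then show ?thesis using assms by (simp add: odd_characters_def)
qed

text \<open>Orthogonality relation. If \<open>a\<close> or \<open>-a\<close> reduces into
  \<open>H\<close>, all summands equal 1 or all equal -1; otherwise the sum is a power sum over the
  roots of \<open>z ^ half_index = - 1\<close> and vanishes.\<close>

lemma sum_odd_characters:
  assumes a: "coprime a (int p)"
  shows "(\<Sum>\<psi>\<in>odd_characters p H. \<psi> a) =
    of_nat (card (odd_characters p H)) *
      (of_bool (a mod int p \<in> H) - of_bool ((- a) mod int p \<in> H))"
proof -
  have minus: "\<psi> a = - 1" if "\<psi> \<in> odd_characters p H" "(- a) mod int p \<in> H" for \<psi>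
    using odd_character_mem[OF that] odd_character_minus[OF that(1), of a] by (metis minus_minus)
  \<comment> \<open>One such character exists, and it cannot take both values 1 and -1 at
    \<open>a\<close>; so the two membership cases exclude each other.\<close>
  obtain \<psi>\<^sub>0 where "\<psi>\<^sub>0 \<in> odd_characters p H"
    using card_odd_characters half_index_pos by (metis card.empty equals0I less_irrefl)
  then have excl: "\<not> (a mod int p \<in> H \<and> (- a) mod int p \<in> H)"
    using minus odd_character_mem by fastforce
  consider "a mod int p \<in> H" | "(- a) mod int p \<in> H"
    | "a mod int p \<notin> H" "(- a) mod int p \<notin> H" by blast
  then show ?thesis
  proof cases
    case 1
    then have "(\<Sum>\<psi>\<in>odd_characters p H. \<psi> a) = (\<Sum>\<psi>\<in>odd_characters p H. 1)"
      by (intro sum.cong) (auto intro: odd_character_mem)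
    with 1 excl show ?thesis by simp
  next
    case 2
    then have "(\<Sum>\<psi>\<in>odd_characters p H. \<psi> a) = (\<Sum>\<psi>\<in>odd_characters p H. - 1)"
      by (intro sum.cong) (auto intro: minus)
    with 2 excl show ?thesis by simp
  next
    case 3
    \<comment> \<open>If \<open>half_index\<close> divided \<open>dlog a\<close>, then
      \<open>a ^ (2 * card H)\<close> would be 1 modulo \<open>p\<close>, so
      \<open>a ^ card H\<close> would be 1 or -1, and as \<open>card H\<close> is odd,
      \<open>a\<close> or \<open>-a\<close> would reduce into \<open>H\<close>.\<close>
    have "\<not> half_index dvd dlog a"
    proof
      assume "half_index dvd dlog a"
      then have "p - Suc 0 dvd dlog a * (2 * card H)"
        by (simp add: card_units mult_dvd_mono mult.commute)
      then have "[(int gen ^ dlog a) ^ (2 * card H) = 1] (mod int p)"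
        unfolding power_mult[symmetric] gen_power_cong_1_iff .
      then have "[a ^ (2 * card H) = 1] (mod int p)"
        by (rule cong_trans[OF cong_pow[OF dlog[OF a]]])
      moreover have "a ^ (2 * card H) - 1 = (a ^ card H - 1) * (a ^ card H + 1)"
        by (simp add: algebra_simps power_mult power2_eq_square mult.commute[of 2])
      ultimately have "int p dvd (a ^ card H - 1) * (a ^ card H + 1)"
        by (simp add: cong_iff_dvd_diff)
      then consider "int p dvd a ^ card H - 1" | "int p dvd a ^ card H + 1"
        using prime by (auto simp: prime_dvd_mult_iff)
      then show False
      proof cases
        case 1
        then show False using 3 a by (simp add: mem_iff cong_iff_dvd_diff)
      next
        case 2
        have "(- a) ^ card H - 1 = - (a ^ card H + 1)" using odd_card by simp
        with 2 have "int p dvd (- a) ^ card H - 1" by (metis dvd_minus_iff)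
        then show False using 3 a by (simp add: mem_iff cong_iff_dvd_diff)
      qed
    qed
    then have "(\<Sum>z | z ^ half_index = - 1. (z::complex) ^ dlog a) = 0"
      by (rule sum_power_roots[OF half_index_pos])
    then show ?thesis
      using a 3 by (simp add: odd_characters_eq_image sum.reindex[OF inj_on_char_of] char_of_def)
  qed
qed

end

section \<open>The mean square value\<close>

lemma bij_betw_units_mod_mult:
  assumes "m > 0" "coprime b (int m)"
  shows "bij_betw (\<lambda>h. b * h mod int m) (units_mod m) (units_mod m)"
proof -
  let ?f = "\<lambda>h. b * h mod int m"
  have inj: "inj_on ?f (units_mod m)"
  proof (rule inj_onI)
    fix x y assume xy: "x \<in> units_mod m" "y \<in> units_mod m" and "?f x = ?f y"
    then have "[b * x = b * y] (mod int m)" by (simp add: cong_def)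
    then have "[x = y] (mod int m)" using assms(2) by (simp add: cong_mult_lcancel)
    with xy show "x = y" by (intro cong_less_imp_eq_int[of x "int m" y]) (auto simp: units_mod_def)
  qed
  have "?f ` units_mod m \<subseteq> units_mod m"
    using assms by (auto intro!: mod_in_units_mod simp: units_mod_def)
  from endo_inj_surj[OF finite_units_mod this inj] have "?f ` units_mod m = units_mod m" .
  with inj show ?thesis unfolding bij_betw_def by (rule conjI)
qed

text \<open>The sieve only imposes coprimality to \<open>d\<close>; this separates the units modulo
  \<open>d * p\<close> from the multiples of \<open>p\<close>. The factor in \<open>d * 1\<close>
  matches \<open>sum_cot_coprime\<close> at \<open>k = 1\<close>.\<close>

lemma units_mod_conv_coprime:
  assumes "d > 0" "prime p"
  shows "{b \<in> {1..int (d * p) - 1}. coprime b (int d)} =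
    units_mod (d * p) \<union> (\<lambda>b. int p * b) ` {b \<in> {1..int (d * 1) - 1}. coprime (int p * b) (int d)}"
    (is "?A = ?B \<union> ?C")
    and "units_mod (d * p) \<inter>
      (\<lambda>b. int p * b) ` {b \<in> {1..int (d * 1) - 1}. coprime (int p * b) (int d)} = {}"
proof -
  have p: "p > 1" using assms(2) by (rule prime_gt_1_nat)
  have cop: "coprime b (int p) \<longleftrightarrow> \<not> int p dvd b" for b
    using p prime_imp_coprime[of "int p" b] coprime_absorb_left[of "int p" b] assms(2)
    by (metis coprime_commute not_prime_unit prime_nat_int_transfer)
  show "?A = ?B \<union> ?C"
  proof (intro equalityI subsetI)
    fix b assume b: "b \<in> ?A"
    show "b \<in> ?B \<union> ?C"
    proof (cases "int p dvd b")
      case True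
      then obtain c where c: "b = int p * c" by auto
      have "1 \<le> int p * c" "int p * c < int p * int d" using b by (auto simp: c mult.commute)
      then have "0 < int p * c" "int p * c < int p * int d" by simp_all
      then have "0 < c" "c < int d"
        using p by (simp_all only: zero_less_mult_pos[of "int p"] mult_less_cancel_left_pos[of "int p"] of_nat_0_less_iff)
      then show ?thesis using b c by auto
    next
      case False
      then have "coprime b (int p)" unfolding cop .
      then show ?thesis using b by (simp add: units_mod_def)
    qed
  next
    fix b assume b: "b \<in> ?B \<union> ?C"
    then show "b \<in> ?A"
    proof
      assume b: "b \<in> ?B"
      then have "coprime b (int p)" by (simp add: units_mod_def)
      then have "b \<noteq> 0" unfolding cop by auto
      then show ?thesis using b by (auto simp: units_mod_def)
    next
      assume "b \<in> ?C"
      then obtain c where c: "b = int p * c" "1 \<le> c" "c < int d" "coprime (int p * c) (int d)" by auto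
      have "int p * c < int p * int d" using c p by simp
      moreover have "0 < int p * c" using c p by (intro mult_pos_pos) simp_all
      ultimately show ?thesis using c(4) unfolding c(1) by (simp add: mult.commute[of "int d"])
    qed
  qed
  have False if "int p * c \<in> units_mod (d * p)" for c
  proof -
    have "coprime (int p * c) (int p)" using that by (simp add: units_mod_def)
    then show False unfolding cop by simp
  qed
  then show "?B \<inter> ?C = {}" by blast
qed

text \<open>The multiples of \<open>p\<close> contribute the same kind of sum with modulus
  \<open>d\<close> in place of \<open>d * p\<close>, so the sum over units is the sieved sum at
  \<open>k = p\<close> minus the one at \<open>k = 1\<close>.\<close>

lemma sum_cot_units_mod:
  assumes "squarefree d" "prime p" "\<not> p dvd d"
  shows "(\<Sum>b\<in>units_mod (d * p). cot (pi * real_of_int b / real (d * p)) *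
      cot (pi * real_of_int b * real_of_int h / real (d * p))) =
    4 * real p * (\<Sum>\<delta> | \<delta> dvd d. real_of_int (moebius_mu (d div \<delta>)) * real \<delta> * dedekind_sum h (int (\<delta> * p))) -
    4 * (\<Sum>\<delta> | \<delta> dvd d. real_of_int (moebius_mu (d div \<delta>)) * real \<delta> * dedekind_sum h (int \<delta>))"
proof -
  have d: "d > 0" using assms(1) by (metis not_squarefree_0 gr0I)
  have p: "p > 0" using assms(2) by (rule prime_gt_0_nat)
  have cop: "coprime (int p) (int d)" using assms by (simp add: prime_imp_coprime)
  let ?F = "\<lambda>b. cot (pi * real_of_int b / real (d * p)) * cot (pi * real_of_int b * real_of_int h / real (d * p))"
  let ?C = "{b \<in> {1..int (d * 1) - 1}. coprime (int p * b) (int d)}"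
  have finC: "finite ?C" by (rule finite_subset[of _ "{1..int (d * 1) - 1}"]) auto
  have C: "?C = {b. b \<in> {1..int (d * 1) - 1} \<and> coprime b (int d)}" using cop by auto
  have "(\<Sum>b | b \<in> {1..int (d * p) - 1} \<and> coprime b (int d). ?F b) =
      (\<Sum>b\<in>units_mod (d * p). ?F b) + (\<Sum>b\<in>(\<lambda>b. int p * b) ` ?C. ?F b)"
    unfolding units_mod_conv_coprime(1)[OF d assms(2)]
    by (rule sum.union_disjoint[OF finite_units_mod finite_imageI[OF finC] units_mod_conv_coprime(2)[OF d assms(2)]])
  also have "(\<Sum>b\<in>(\<lambda>b. int p * b) ` ?C. ?F b) = (\<Sum>b\<in>?C. ?F (int p * b))"
    using p by (simp add: sum.reindex inj_on_def)
  also have "\<dots> = (\<Sum>b | b \<in> {1..int (d * 1) - 1} \<and> coprime b (int d).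
      cot (pi * real_of_int b / real (d * 1)) * cot (pi * real_of_int b * real_of_int h / real (d * 1)))"
    unfolding C
  proof (rule sum.cong)
    fix b
    have "pi * real_of_int (int p * b) / real (d * p) = pi * real_of_int b / real (d * 1)"
      "pi * real_of_int (int p * b) * real_of_int h / real (d * p) = pi * real_of_int b * real_of_int h / real (d * 1)"
      using p by simp_all
    then show "?F (int p * b) = cot (pi * real_of_int b / real (d * 1)) * cot (pi * real_of_int b * real_of_int h / real (d * 1))"
      by (simp only:)
  qed simp
  also have "\<dots> = 4 * real 1 * (\<Sum>\<delta> | \<delta> dvd d. real_of_int (moebius_mu (d div \<delta>)) * real \<delta> * dedekind_sum h (int (\<delta> * 1)))"
    by (rule sum_cot_coprime) (use assms in auto)
  finally show ?thesis
    unfolding sum_cot_coprime[OF assms(1) p] by simp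
qed

text \<open>In the double sum over \<open>a\<close> and \<open>b\<close>, the substitution
  \<open>a = b * h\<close> makes the character value at \<open>b\<close> cancel against its
  conjugate, leaving only the value at \<open>h\<close>.\<close>

lemma norm_square_character_sum:
  assumes "dirichlet_character p \<psi>" "p > 1" "d > 0"
  shows "complex_of_real ((cmod (\<Sum>a\<in>units_mod (d * p). \<psi> a * of_real (cot (pi * real_of_int a / real (d * p)))))\<^sup>2) =
    (\<Sum>h\<in>units_mod (d * p). \<psi> h * of_real (\<Sum>b\<in>units_mod (d * p).
      cot (pi * real_of_int b / real (d * p)) * cot (pi * real_of_int b * real_of_int h / real (d * p))))"
proof -
  define m where "m = d * p"
  have m: "m > 0" using assms by (simp add: m_def)
  define c where "c x = cot (pi * real_of_int x / real m)" for x
  have c_cong: "c x = c y" if xy: "[x = y] (mod int m)" for x y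
  proof -
    obtain k where "y = x + int m * k" using xy by (auto simp: cong_iff_lin)
    then have "pi * real_of_int y / real m = pi * real_of_int x / real m + pi * real_of_int k"
      using m by (simp add: field_simps)
    then show ?thesis by (simp only: c_def cot_add_int_pi)
  qed
  have \<psi>_cong: "\<psi> x = \<psi> y" if "[x = y] (mod int m)" for x y
    by (rule dirichlet_character_cong[OF assms(1)], rule cong_dvd_modulus[OF that]) (simp add: m_def)
  have mult: "\<psi> (x * y) = \<psi> x * \<psi> y" for x y
    using assms(1) by (simp add: dirichlet_character_def)
  have inner: "(\<Sum>a\<in>units_mod m. \<psi> a * of_real (c a) * cnj (\<psi> b * of_real (c b))) =
      (\<Sum>h\<in>units_mod m. \<psi> h * of_real (c b * c (b * h)))" if b: "b \<in> units_mod m" for b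
  proof -
    have cop: "coprime b (int m)" using b by (simp add: units_mod_def)
    then have "coprime b (int p)" by (simp add: m_def)
    then have "cmod (\<psi> b) = 1" by (rule norm_dirichlet_character[OF assms(1,2)])
    then have one: "\<psi> b * cnj (\<psi> b) = 1" by (simp only: complex_norm_square[symmetric]) simp
    \<comment> \<open>The substitution \<open>a = b * h\<close>, which permutes the units because
      \<open>b\<close> is one.\<close>
    have "(\<Sum>a\<in>units_mod m. \<psi> a * of_real (c a) * cnj (\<psi> b * of_real (c b))) =
      (\<Sum>h\<in>units_mod m. \<psi> (b * h mod int m) * of_real (c (b * h mod int m)) * cnj (\<psi> b * of_real (c b)))"
      by (rule sum.reindex_bij_betw[OF bij_betw_units_mod_mult[OF m cop], symmetric])
    also have "\<dots> = (\<Sum>h\<in>units_mod m. \<psi> h * of_real (c b * c (b * h)))"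
    proof (rule sum.cong)
      fix h
      have "\<psi> (b * h mod int m) = \<psi> b * \<psi> h" "c (b * h mod int m) = c (b * h)"
        using \<psi>_cong[of "b * h mod int m" "b * h"] c_cong[of "b * h mod int m" "b * h"]
        by (simp_all add: mult cong_def)
      then have "\<psi> (b * h mod int m) * of_real (c (b * h mod int m)) * cnj (\<psi> b * of_real (c b)) =
          (\<psi> b * cnj (\<psi> b)) * (\<psi> h * of_real (c b * c (b * h)))"
        by (simp add: mult_ac)
      then show "\<psi> (b * h mod int m) * of_real (c (b * h mod int m)) * cnj (\<psi> b * of_real (c b)) =
          \<psi> h * of_real (c b * c (b * h))"
        by (simp add: one)
    qed simp
    finally show ?thesis .
  qed
  have "complex_of_real ((cmod (\<Sum>a\<in>units_mod m. \<psi> a * of_real (c a)))\<^sup>2) =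
      (\<Sum>b\<in>units_mod m. \<Sum>a\<in>units_mod m. \<psi> a * of_real (c a) * cnj (\<psi> b * of_real (c b)))"
    unfolding complex_norm_square cnj_sum sum_product by (rule sum.swap)
  also have "\<dots> = (\<Sum>b\<in>units_mod m. \<Sum>h\<in>units_mod m. \<psi> h * of_real (c b * c (b * h)))"
    by (rule sum.cong) (simp_all only: inner)
  also have "\<dots> = (\<Sum>h\<in>units_mod m. \<Sum>b\<in>units_mod m. \<psi> h * of_real (c b * c (b * h)))"
    by (rule sum.swap)
  finally show ?thesis
    by (simp add: m_def c_def sum_distrib_left mult.assoc)
qed

text \<open>The induced character is odd, has period \<open>d * p\<close> and vanishes off the
  units, so the cotangent formula reduces to a sum over units.\<close>

lemma (in odd_order_subgroup) dirichlet_L_induced: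
  assumes "\<psi> \<in> odd_characters p H" "d > 0"
  shows "dirichlet_L 1 (induced_character (d * p) \<psi>) = of_real (pi / (2 * real (d * p))) *
    (\<Sum>a\<in>units_mod (d * p). \<psi> a * of_real (cot (pi * real_of_int a / real (d * p))))"
proof -
  let ?m = "d * p" and ?\<psi> = "induced_character (d * p) \<psi>"
  have m: "?m > 0" "?m > 1" using assms(2) ge3 by (auto intro: less_le_trans[of _ p])
  have dir: "dirichlet_character p \<psi>" using assms(1) by (simp add: odd_characters_def)
  have "?\<psi> (a + int ?m) = ?\<psi> a" for a
  proof -
    have "\<psi> (a + int ?m) = \<psi> a" by (rule dirichlet_character_cong[OF dir]) (simp add: cong_def)
    moreover have "coprime (a + int ?m) (int ?m) \<longleftrightarrow> coprime a (int ?m)"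
      by (metis coprime_iff_gcd_eq_1 gcd_add1)
    ultimately show ?thesis by (simp only: induced_character_def)
  qed
  moreover have "?\<psi> (- a) = - ?\<psi> a" for a
    using odd_character_minus[OF assms(1)] by (simp add: induced_character_def)
  ultimately have "dirichlet_L 1 ?\<psi> = of_real (pi / (2 * real ?m)) *
      (\<Sum>a=1..int ?m - 1. ?\<psi> a * of_real (cot (pi * real_of_int a / real ?m)))"
    by (intro dirichlet_L_odd_periodic m(1))
  also have "(\<Sum>a=1..int ?m - 1. ?\<psi> a * of_real (cot (pi * real_of_int a / real ?m))) =
      (\<Sum>a\<in>units_mod ?m. \<psi> a * of_real (cot (pi * real_of_int a / real ?m)))"
  proof (rule sum.mono_neutral_cong_right)
    have "a \<noteq> 0" if "a \<in> units_mod ?m" for a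
      using that m(2) by (auto simp: units_mod_def)
    then show "units_mod ?m \<subseteq> {1..int ?m - 1}" by (fastforce simp: units_mod_def)
    show "\<forall>a\<in>{1..int ?m - 1} - units_mod ?m. ?\<psi> a * of_real (cot (pi * real_of_int a / real ?m)) = 0"
      by (auto simp: units_mod_def induced_character_def)
  qed (auto simp: units_mod_def induced_character_def)
  finally show ?thesis .
qed

text \<open>Orthogonality leaves the \<open>h\<close> lying over \<open>H\<close> with weight 1 and
  those lying over \<open>-H\<close> with weight -1. The cotangent sum is odd in \<open>h\<close>,
  so both contribute equally, which turns the factor 1/4 of the squared L-values into 1/2.\<close>

lemma (in odd_order_subgroup) sum_norm_square_L:
  assumes d: "d > 0"
  shows "(\<Sum>\<psi>\<in>odd_characters p H. (cmod (dirichlet_L 1 (induced_character (d * p) \<psi>)))\<^sup>2) =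
    real (card (odd_characters p H)) * (pi\<^sup>2 / (2 * (real (d * p))\<^sup>2) *
      (\<Sum>h\<in>canon_preimage d p H. \<Sum>b\<in>units_mod (d * p).
        cot (pi * real_of_int b / real (d * p)) * cot (pi * real_of_int b * real_of_int h / real (d * p))))"
    (is "?lhs = _")
proof -
  define m where "m = d * p"
  have m: "m > 1" using d ge3 by (auto simp: m_def intro: less_le_trans[of _ p])
  define T where "T h = (\<Sum>b\<in>units_mod m. cot (pi * real_of_int b / real m) *
      cot (pi * real_of_int b * real_of_int h / real m))" for h
  define n where "n = card (odd_characters p H)"
  let ?\<epsilon> = "\<lambda>h. of_bool (h mod int p \<in> H) :: real"
  have L: "complex_of_real ((cmod (dirichlet_L 1 (induced_character m \<psi>)))\<^sup>2) =
      of_real ((pi / (2 * real m))\<^sup>2) * (\<Sum>h\<in>units_mod m. \<psi> h * of_real (T h))"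
    if \<psi>: "\<psi> \<in> odd_characters p H" for \<psi>
  proof -
    have "dirichlet_character p \<psi>" using \<psi> by (simp add: odd_characters_def)
    then show ?thesis
      using ge3 d unfolding m_def T_def dirichlet_L_induced[OF \<psi> d]
      by (simp only: norm_mult power_mult_distrib of_real_mult norm_square_character_sum norm_of_real power2_abs)
  qed
  have "complex_of_real ?lhs = (\<Sum>\<psi>\<in>odd_characters p H.
      of_real ((pi / (2 * real m))\<^sup>2) * (\<Sum>h\<in>units_mod m. \<psi> h * of_real (T h)))"
    unfolding of_real_sum by (rule sum.cong) (simp_all only: L m_def[symmetric])
  also have "\<dots> = of_real ((pi / (2 * real m))\<^sup>2) *
      (\<Sum>\<psi>\<in>odd_characters p H. \<Sum>h\<in>units_mod m. \<psi> h * of_real (T h))"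
    by (rule sum_distrib_left[symmetric])
  also have "(\<Sum>\<psi>\<in>odd_characters p H. \<Sum>h\<in>units_mod m. \<psi> h * complex_of_real (T h)) =
      (\<Sum>h\<in>units_mod m. \<Sum>\<psi>\<in>odd_characters p H. \<psi> h * of_real (T h))"
    by (rule sum.swap)
  also have "\<dots> = (\<Sum>h\<in>units_mod m. (\<Sum>\<psi>\<in>odd_characters p H. \<psi> h) * of_real (T h))"
    by (simp only: sum_distrib_right)
  also have "(\<Sum>h\<in>units_mod m. (\<Sum>\<psi>\<in>odd_characters p H. \<psi> h) * of_real (T h)) =
      (\<Sum>h\<in>units_mod m. of_real (real n * (?\<epsilon> h - ?\<epsilon> (- h)) * T h))"
  proof (rule sum.cong)
    fix h assume "h \<in> units_mod m"
    then have "coprime h (int p)" by (simp add: units_mod_def m_def)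
    then show "(\<Sum>\<psi>\<in>odd_characters p H. \<psi> h) * of_real (T h) = of_real (real n * (?\<epsilon> h - ?\<epsilon> (- h)) * T h)"
      by (simp add: sum_odd_characters n_def)
  qed simp
  also have "of_real ((pi / (2 * real m))\<^sup>2) * \<dots> =
      complex_of_real ((pi / (2 * real m))\<^sup>2 * (\<Sum>h\<in>units_mod m. real n * (?\<epsilon> h - ?\<epsilon> (- h)) * T h))"
    by (simp only: of_real_mult of_real_sum)
  finally have "?lhs = (pi / (2 * real m))\<^sup>2 * (\<Sum>h\<in>units_mod m. real n * (?\<epsilon> h - ?\<epsilon> (- h)) * T h)"
    unfolding of_real_eq_iff .
  also have "(\<Sum>h\<in>units_mod m. real n * (?\<epsilon> h - ?\<epsilon> (- h)) * T h) =
      real n * ((\<Sum>h\<in>units_mod m. ?\<epsilon> h * T h) - (\<Sum>h\<in>units_mod m. ?\<epsilon> (- h) * T h))"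
    unfolding sum_subtractf[symmetric] sum_distrib_left[of "real n"]
    by (rule sum.cong) (simp_all only: algebra_simps)
  \<comment> \<open>Substituting \<open>m - h\<close> for \<open>h\<close>, the representative of
    the negative among the least residues.\<close>
  also have "(\<Sum>h\<in>units_mod m. ?\<epsilon> (- h) * T h) = (\<Sum>h\<in>units_mod m. ?\<epsilon> h * T (- h))"
  proof (rule sum.reindex_bij_witness[of _ "\<lambda>h. int m - h" "\<lambda>h. int m - h"])
    fix h
    have "[int m - h = - h] (mod int p)" by (simp add: cong_iff_dvd_diff m_def)
    then have "(int m - h) mod int p = (- h) mod int p" by (simp only: cong_def)
    moreover have "T (- (int m - h)) = T h"
    proof -
      have "cot (pi * real_of_int b * real_of_int (- (int m - h)) / real m) =
          cot (pi * real_of_int b * real_of_int h / real m)" for b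
      proof -
        have "pi * real_of_int b * real_of_int (- (int m - h)) / real m =
            pi * real_of_int b * real_of_int h / real m + pi * real_of_int (- b)"
          using m by (simp add: field_simps)
        then show ?thesis by (simp only: cot_add_int_pi)
      qed
      then show ?thesis by (simp only: T_def)
    qed
    ultimately show "?\<epsilon> (int m - h) * T (- (int m - h)) = ?\<epsilon> (- h) * T h" by (simp only:)
  qed (simp_all add: minus_in_units_mod[OF m])
  also have "\<dots> = - (\<Sum>h\<in>units_mod m. ?\<epsilon> h * T h)"
    by (simp add: T_def sum_negf)
  also have "(\<Sum>h\<in>units_mod m. ?\<epsilon> h * T h) = (\<Sum>h\<in>canon_preimage d p H. T h)"
    using m by (intro sum.mono_neutral_cong_right) (auto simp: canon_preimage_eq m_def)
  finally show ?thesis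
    by (simp add: T_def m_def n_def power_divide power_mult_distrib)
qed

text \<open>The number of characters is nonzero and cancels; what remains is evaluated by
  \<open>sum_cot_units_mod\<close>, where only the moduli \<open>\<delta> * p\<close>
  survive.\<close>

lemma (in odd_order_subgroup) mean_square_L_eq:
  assumes "d > 1" "squarefree d" "\<not> p dvd d"
  shows "mean_square_L d p H = 2 * pi\<^sup>2 * real_of_int (moebius_mu d) / ((real d)\<^sup>2 * real p) *
    (\<Sum>\<delta> | \<delta> dvd d. real \<delta> * real_of_int (moebius_mu \<delta>) *
      (\<Sum>h\<in>canon_preimage d p H. dedekind_sum h (int (\<delta> * p))))"
proof -
  let ?H = "canon_preimage d p H"
  let ?\<mu> = "\<lambda>n. real_of_int (moebius_mu n)"
  have n: "real (card (odd_characters p H)) \<noteq> 0"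
    using card_odd_characters half_index_pos by simp
  have p: "p > 0" using ge3 by simp
  \<comment> \<open>For \<open>\<delta>\<close> dividing \<open>d\<close>, the summand depends only
    on \<open>h\<close> modulo \<open>d\<close> and is odd, so the units modulo \<open>d\<close>
    cancel in pairs.\<close>
  have zero: "(\<Sum>h\<in>?H. dedekind_sum h (int \<delta>)) = 0" if "\<delta> dvd d" for \<delta>
  proof -
    have "coprime d p"
      using assms(3) prime by (metis coprime_commute prime_imp_coprime)
    have "dedekind_sum (int d - u) (int \<delta>) = - dedekind_sum u (int \<delta>)" for u
      using that dedekind_sum_cong[of "int d - u" "- u" "int \<delta>"] dedekind_sum_minus
      by (simp add: cong_iff_dvd_diff)
    then have "(\<Sum>h\<in>?H. dedekind_sum (h mod int d) (int \<delta>)) = 0"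
      using assms(1) ge3 \<open>coprime d p\<close> by (intro sum_canon_preimage_odd) auto
    then show ?thesis using that by (simp add: dedekind_sum_mod)
  qed
  have "(\<Sum>h\<in>?H. \<Sum>b\<in>units_mod (d * p). cot (pi * real_of_int b / real (d * p)) *
        cot (pi * real_of_int b * real_of_int h / real (d * p))) =
      4 * real p * (\<Sum>\<delta> | \<delta> dvd d. ?\<mu> (d div \<delta>) * real \<delta> * (\<Sum>h\<in>?H. dedekind_sum h (int (\<delta> * p)))) -
      4 * (\<Sum>\<delta> | \<delta> dvd d. ?\<mu> (d div \<delta>) * real \<delta> * (\<Sum>h\<in>?H. dedekind_sum h (int \<delta>)))"
    unfolding sum_cot_units_mod[OF assms(2) prime assms(3)] sum_subtractf sum_distrib_left
    by (simp only: sum.swap[of _ ?H])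
  also have "(\<Sum>\<delta> | \<delta> dvd d. ?\<mu> (d div \<delta>) * real \<delta> * (\<Sum>h\<in>?H. dedekind_sum h (int \<delta>))) = 0"
    by (simp add: zero)
  also have "(\<Sum>\<delta> | \<delta> dvd d. ?\<mu> (d div \<delta>) * real \<delta> * (\<Sum>h\<in>?H. dedekind_sum h (int (\<delta> * p)))) =
      ?\<mu> d * (\<Sum>\<delta> | \<delta> dvd d. real \<delta> * ?\<mu> \<delta> * (\<Sum>h\<in>?H. dedekind_sum h (int (\<delta> * p))))"
    unfolding sum_distrib_left
    by (rule sum.cong) (simp_all add: moebius_mu_cofactor[OF assms(2)] mult_ac)
  finally have T: "(\<Sum>h\<in>?H. \<Sum>b\<in>units_mod (d * p). cot (pi * real_of_int b / real (d * p)) *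
        cot (pi * real_of_int b * real_of_int h / real (d * p))) =
      4 * real p * (?\<mu> d * (\<Sum>\<delta> | \<delta> dvd d. real \<delta> * ?\<mu> \<delta> * (\<Sum>h\<in>?H. dedekind_sum h (int (\<delta> * p)))))"
    by simp
  have d: "d > 0" using assms(1) by simp
  show ?thesis
    unfolding mean_square_L_def sum_norm_square_L[OF d] T
    using n p d by (simp add: field_simps power2_eq_square)
qed

section \<open>Passage to the preimages at each divisor, and the quantities N and kappa\<close>

text \<open>The summand depends only on \<open>h\<close> modulo \<open>\<delta> * f\<close>, and
  every fibre of reduction has \<open>totient (d div \<delta>)\<close> elements, which is the
  quotient of the two totients as \<open>d\<close> is square-free.\<close>

lemma sum_dedekind_fibre:
  assumes "squarefree d" "f > 1" "coprime f d" "\<delta> dvd d"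
  shows "(\<Sum>h\<in>canon_preimage d f A. dedekind_sum h (int (\<delta> * f))) =
    real (totient d) / real (totient \<delta>) * sum_dedekind (canon_preimage \<delta> f A) (\<delta> * f)"
proof -
  obtain e where e: "d = \<delta> * e" using assms(4) by auto
  have "d > 0" using assms(1) by (metis not_squarefree_0 gr0I)
  then have pos: "\<delta> > 0" "e > 0" by (auto simp: e)
  have cop: "coprime \<delta> e" using squarefree_cofactor[OF assms(1,4)] pos by (simp add: e)
  moreover have "coprime f e" using assms(3) by (simp add: e)
  ultimately have "coprime (\<delta> * f) e" by simp
  from sum_canon_preimage_fibre[OF pos assms(2) this, of "\<lambda>h. dedekind_sum h (int (\<delta> * f))" A]
  have "(\<Sum>h\<in>canon_preimage d f A. dedekind_sum h (int (\<delta> * f))) =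
      real (totient e) * (\<Sum>h\<in>canon_preimage \<delta> f A. dedekind_sum h (int (\<delta> * f)))"
    by (simp only: dedekind_sum_mod[OF dvd_refl] e)
  moreover have "real (totient d) = real (totient \<delta>) * real (totient e)"
    using cop by (simp add: e totient_mult_coprime)
  ultimately show ?thesis using pos by (simp add: sum_dedekind_def)
qed

text \<open>Factoring \<open>q^2 - 1\<close> splits off the product of the \<open>q - 1\<close>,
  which is \<open>totient d\<close>; this is where the products of \<open>q + 1\<close> come
  from.\<close>

lemma prod_square_minus_1:
  assumes "squarefree d"
  shows "(\<Prod>q\<in>prime_factors d. (real q)\<^sup>2 - 1) = real (totient d) * (\<Prod>q\<in>prime_factors d. real q + 1)"
proof -
  have "(\<Prod>q\<in>prime_factors d. (real q)\<^sup>2 - 1) = (\<Prod>q\<in>prime_factors d. (real q - 1) * (real q + 1))"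
    by (rule prod.cong) (simp_all add: power2_eq_square square_diff_one_factored mult.commute)
  also have "\<dots> = (\<Prod>q\<in>prime_factors d. real q - 1) * (\<Prod>q\<in>prime_factors d. real q + 1)"
    by (rule prod.distrib)
  finally show ?thesis by (simp only: totient_squarefree(2)[OF assms])
qed

text \<open>Exhibits in \<open>kappa\<close> the same product that is the denominator in
  \<open>N_term\<close>, so that the two cancel.\<close>

lemma kappa_squarefree:
  assumes "squarefree d"
  shows "kappa d = pi\<^sup>2 / 6 * ((\<Prod>q\<in>prime_factors d. (real q)\<^sup>2 - 1) / (real d)\<^sup>2)"
proof -
  have "(real d)\<^sup>2 = (\<Prod>q\<in>prime_factors d. (real q)\<^sup>2)"
    unfolding totient_squarefree(1)[OF assms] by (rule prod_power_distrib)
  moreover have "(\<Prod>q\<in>prime_factors d. 1 - 1 / (real q)\<^sup>2) =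
      (\<Prod>q\<in>prime_factors d. ((real q)\<^sup>2 - 1) / (real q)\<^sup>2)"
    by (rule prod.cong) (auto simp: field_simps dest!: in_prime_factors_imp_prime prime_gt_0_nat)
  ultimately show ?thesis by (simp add: kappa_def prod_dividef)
qed

text \<open>The factor \<open>totient d\<close> gained from the fibres cancels against the one in
  \<open>prod_square_minus_1\<close>. As \<open>A\<close> is arbitrary, the formula serves both
  \<open>H\<close> and \<open>{1}\<close>.\<close>

lemma N_term_eq:
  assumes "squarefree d" "f > 1" "coprime f d"
  shows "N_term d f A = - real f +
    12 * real_of_int (moebius_mu d) / (\<Prod>q\<in>prime_factors d. real q + 1) *
    (\<Sum>\<delta> | \<delta> dvd d. real \<delta> * real_of_int (moebius_mu \<delta>) / real (totient \<delta>) *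
      sum_dedekind (canon_preimage \<delta> f A) (\<delta> * f))"
proof -
  have "d > 0" using assms(1) by (metis not_squarefree_0 gr0I)
  then have "real (totient d) \<noteq> 0" by simp
  moreover have "(\<Sum>\<delta> | \<delta> dvd d. real \<delta> * real_of_int (moebius_mu \<delta>) *
        (\<Sum>h\<in>canon_preimage d f A. dedekind_sum h (int (\<delta> * f)))) =
      real (totient d) * (\<Sum>\<delta> | \<delta> dvd d. real \<delta> * real_of_int (moebius_mu \<delta>) / real (totient \<delta>) *
        sum_dedekind (canon_preimage \<delta> f A) (\<delta> * f))"
    unfolding sum_distrib_left[of "real (totient d)"]
    by (rule sum.cong) (simp_all add: sum_dedekind_fibre[OF assms] del: of_nat_mult)
  ultimately show ?thesis
    by (simp add: N_term_def prod_square_minus_1[OF assms(1)])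
qed

text \<open>An \<open>h\<close> coprime to \<open>d * f\<close> is coprime to every
  \<open>\<delta> * f\<close>, so each Dedekind sum involved is rational.\<close>

lemma N_term_rational:
  assumes "d > 0" "f > 1"
  shows "N_term d f A \<in> \<rat>"
proof -
  have "dedekind_sum h (int (\<delta> * f)) \<in> \<rat>" if "\<delta> dvd d" "h \<in> canon_preimage d f A" for \<delta> h
  proof -
    have df: "d * f > 1" using assms by (auto intro: less_le_trans[of _ f])
    have h: "0 \<le> h" "coprime h (int (d * f))"
      using that(2) by (auto simp: canon_preimage_eq[OF df] units_mod_def)
    have "coprime h (int (\<delta> * f))"
      by (rule coprime_divisors[OF _ _ h(2)]) (use that(1) in \<open>auto intro: mult_dvd_mono\<close>)
    then have "coprime (nat h) (\<delta> * f)"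
      using h(1) by (metis coprime_int_iff int_nat_eq)
    moreover have "\<delta> * f > 0" using that(1) assms by (auto intro: Nat.gr0I)
    ultimately have "dedekind_sum (int (nat h)) (int (\<delta> * f)) \<in> \<rat>"
      by (intro dedekind_sum_rational)
    then show ?thesis using h(1) by simp
  qed
  then show ?thesis
    unfolding N_term_def
    by (intro Rats_add Rats_minus_iff[THEN iffD2] Rats_mult Rats_divide Rats_sum Rats_prod Rats_diff
        Rats_power Rats_of_nat Rats_of_int Rats_1 Rats_number_of) auto
qed

lemma sum_dedekind_remove_one:
  assumes "\<delta> * f > 1" "1 \<in> A"
  shows "sum_dedekind (canon_preimage \<delta> f A) m =
    sum_dedekind (canon_preimage \<delta> f {1}) m + sum_dedekind (canon_preimage \<delta> f (A - {1})) m"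
proof -
  have "canon_preimage \<delta> f A = canon_preimage \<delta> f {1} \<union> canon_preimage \<delta> f (A - {1})"
    using assms(2) by (auto simp: canon_preimage_def)
  then show ?thesis
    unfolding sum_dedekind_def
    by (simp only:) (rule sum.union_disjoint; auto simp: canon_preimage_eq[OF assms(1)])
qed

theorem theorem4p3:
  fixes d0 :: nat
  assumes "d0 > 1" and "squarefree d0"
  shows "(\<forall>(p::nat) H. prime p \<and> p \<ge> 3 \<and> \<not> p dvd d0 \<and>
             subgroup H (unit_group_mod p) \<and> odd (card H) \<longrightarrow>
           mean_square_L d0 p H =
             2 * pi\<^sup>2 * real_of_int (moebius_mu d0) * real (totient d0) / ((real d0)\<^sup>2 * real p) *
             (\<Sum>\<delta> | \<delta> dvd d0. real \<delta> * real_of_int (moebius_mu \<delta>) / real (totient \<delta>) *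
                sum_dedekind (canon_preimage \<delta> p H) (\<delta> * p)) \<and>
           mean_square_L d0 p H = kappa d0 * (1 + N_term d0 p H / real p)) \<and>
         (\<forall>(f::nat) H. f > 2 \<and> coprime f d0 \<and> subgroup H (unit_group_mod f) \<longrightarrow>
           N_term d0 f H \<in> \<rat> \<and>
           N_term d0 f H =
             - real f +
             12 * real_of_int (moebius_mu d0) / (\<Prod>q\<in>prime_factors d0. real q + 1) *
             (\<Sum>\<delta> | \<delta> dvd d0. real \<delta> * real_of_int (moebius_mu \<delta>) / real (totient \<delta>) *
                sum_dedekind (canon_preimage \<delta> f H) (\<delta> * f)) \<and>
           N_term d0 f H =
             N_term d0 f {1} +
             12 * real_of_int (moebius_mu d0) / (\<Prod>q\<in>prime_factors d0. real q + 1) *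
             (\<Sum>\<delta> | \<delta> dvd d0. real \<delta> * real_of_int (moebius_mu \<delta>) / real (totient \<delta>) *
                sum_dedekind (canon_preimage \<delta> f (H - {1})) (\<delta> * f)))"
proof (intro conjI allI impI; elim conjE)
  fix p H
  assume p: "prime p" "p \<ge> 3" "\<not> p dvd d0" and H: "subgroup H (unit_group_mod p)" "odd (card H)"
  interpret odd_order_subgroup p H by (rule odd_order_subgroup.intro) (use p H in auto)
  have cop: "coprime p d0" using p by (simp add: prime_imp_coprime)
  have pos: "real p > 0" "real d0 > 0" using p assms by auto
  note M = mean_square_L_eq[OF assms p(3)]
  have "(\<Sum>\<delta> | \<delta> dvd d0. real \<delta> * real_of_int (moebius_mu \<delta>) *
        (\<Sum>h\<in>canon_preimage d0 p H. dedekind_sum h (int (\<delta> * p)))) =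
      real (totient d0) * (\<Sum>\<delta> | \<delta> dvd d0. real \<delta> * real_of_int (moebius_mu \<delta>) / real (totient \<delta>) *
        sum_dedekind (canon_preimage \<delta> p H) (\<delta> * p))"
    unfolding sum_distrib_left[of "real (totient d0)"] using p
    by (intro sum.cong) (simp_all add: sum_dedekind_fibre[OF assms(2) _ cop] del: of_nat_mult)
  then show "mean_square_L d0 p H =
      2 * pi\<^sup>2 * real_of_int (moebius_mu d0) * real (totient d0) / ((real d0)\<^sup>2 * real p) *
      (\<Sum>\<delta> | \<delta> dvd d0. real \<delta> * real_of_int (moebius_mu \<delta>) / real (totient \<delta>) *
        sum_dedekind (canon_preimage \<delta> p H) (\<delta> * p))"
    by (simp add: M)
  define P where "P = (\<Prod>q\<in>prime_factors d0. (real q)\<^sup>2 - 1)"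
  have "(real q)\<^sup>2 - 1 \<noteq> 0" if "q \<in> prime_factors d0" for q
  proof -
    have "real q > 1" using that by (auto dest!: in_prime_factors_imp_prime prime_gt_1_nat)
    then show ?thesis by (auto simp: power2_eq_1_iff)
  qed
  then have "P \<noteq> 0" by (simp add: P_def)
  \<comment> \<open>In \<open>1 + N_term d0 p H / p\<close> the summand \<open>- p\<close> of
    \<open>N_term\<close> cancels the 1, and \<open>P\<close> cancels against the numerator in
    \<open>kappa d0\<close>.\<close>
  then show "mean_square_L d0 p H = kappa d0 * (1 + N_term d0 p H / real p)"
    using pos unfolding M N_term_def kappa_squarefree[OF assms(2)] P_def[symmetric]
    by (simp add: field_simps)
next
  fix f H
  assume f: "f > 2" "coprime f d0" and H: "subgroup H (unit_group_mod f)"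
  have f1: "f > 1" using f by simp
  show "N_term d0 f H \<in> \<rat>" using assms f by (intro N_term_rational) auto
  show "N_term d0 f H = - real f +
      12 * real_of_int (moebius_mu d0) / (\<Prod>q\<in>prime_factors d0. real q + 1) *
      (\<Sum>\<delta> | \<delta> dvd d0. real \<delta> * real_of_int (moebius_mu \<delta>) / real (totient \<delta>) *
        sum_dedekind (canon_preimage \<delta> f H) (\<delta> * f))"
    by (rule N_term_eq[OF assms(2) f1 f(2)])
  have one: "1 \<in> H"
    using subgroup.one_closed[OF H] by (simp add: units_of_def residue_ring_def)
  have "sum_dedekind (canon_preimage \<delta> f H) (\<delta> * f) =
      sum_dedekind (canon_preimage \<delta> f {1}) (\<delta> * f) + sum_dedekind (canon_preimage \<delta> f (H - {1})) (\<delta> * f)"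
    if "\<delta> dvd d0" for \<delta>
  proof -
    have "\<delta> > 0" using that assms(1) by (auto intro: Nat.gr0I)
    then have "\<delta> * f > 1" using f1 by (auto intro: less_le_trans[of _ f])
    then show ?thesis using one by (rule sum_dedekind_remove_one)
  qed
  \<comment> \<open>\<open>N_term_eq\<close> rewrites both sides, for \<open>H\<close> and for
    \<open>{1}\<close>; the difference is the part of each sum over \<open>H - {1}\<close>.\<close>
  then show "N_term d0 f H = N_term d0 f {1} +
      12 * real_of_int (moebius_mu d0) / (\<Prod>q\<in>prime_factors d0. real q + 1) *
      (\<Sum>\<delta> | \<delta> dvd d0. real \<delta> * real_of_int (moebius_mu \<delta>) / real (totient \<delta>) *
        sum_dedekind (canon_preimage \<delta> f (H - {1})) (\<delta> * f))"
    unfolding N_term_eq[OF assms(2) f1 f(2)]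
    by (simp add: distrib_left sum.distrib)
qed

end
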